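(* Let $E$ be an $\mathfrak{L}^1$-space, and let $p,q\in[1,\infty)$. Then a subset of $E$ is relatively weakly compact if and only if it is almost $(p,q)$-multi-bounded.
   Context: Banach spaces are over $\mathbb{C}$; $E'$ denotes the dual of $E$ and $E_{[1]}$ its closed unit ball. For $r\in[1,\infty]$, a Banach space $E$ is an $\mathfrak{L}^r$-space (in the sense of Lindenstrauss and Pełczyński) if there is $\lambda>1$ such that, for every finite-dimensional subspace $M$ of $E$, there are a finite-dimensional subspace $N$ of $E$ containing $M$ and an isomorphism $T:N\to\ell^r_{\dim N}$ with $\|T\|\,\|T^{-1}\|\le\lambda$. For $1\le p<\infty$, $n\in\mathbb{N}$ and $\boldsymbol{x}=(x_1,\ldots,x_n)\in E^n$, the weak $p$-summing norm is $$\mu_{p,n}(\boldsymbol{x}):=\sup\Big\{\Big(\sum_{i=1}^n|\langle x_i,\lambda\rangle|^p\Big)^{1/p}:\lambda\in E'_{[1]}\Big\}.$$ For $p,q\in[1,\infty)$ define, for $\boldsymbol{x}=(x_1,\ldots,x_n)\in E^n$, $$\|\boldsymbol{x}\|_n^{(p,q)}:=\sup\Big\{\Big(\sum_{j=1}^n|\langle x_j,\lambda_j\rangle|^q\Big)^{1/q}:\ \boldsymbol{\lambda}=(\lambda_1,\ldots,\lambda_n)\in(E')^n,\ \mu_{p,n}(\boldsymbol{\lambda})\le1\Big\},$$ where $\mu_{p,n}(\boldsymbol\lambda)$ is computed in the Banach space $E'$. For $B\subseteq E$, set $$c_{p,q}(B):=\lim_{n\to\infty}\sup\Big\{\frac{\|(x_1,\ldots,x_n)\|_n^{(p,q)}}{n^{1/q}}:x_1,\ldots,x_n\in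 B\Big\}\in[0,\infty]$$ (the limit always exists and equals the infimum over $n\in\mathbb{N}$). The set $B$ is almost $(p,q)$-multi-bounded if $c_{p,q}(B)=0$. (Suprema are taken in $[0,\infty]$, so the supremum of the empty set is $0$.) *)

theory Defs
  imports "HOL-Analysis.Analysis"
begin

section \<open>Complex Banach spaces\<close>

class complex_normed_vector = real_normed_vector +
  fixes scaleC :: "complex \<Rightarrow> 'a \<Rightarrow> 'a" (infixr \<open>*\<^sub>C\<close> 75)
  assumes scaleC_add_right: "a *\<^sub>C (x + y) = a *\<^sub>C x + a *\<^sub>C y"
    and scaleC_add_left: "(a + b) *\<^sub>C x = a *\<^sub>C x + b *\<^sub>C x"
    and scaleC_scaleC: "a *\<^sub>C b *\<^sub>C x = (a * b) *\<^sub>C x"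
    and scaleR_scaleC: "r *\<^sub>R x = complex_of_real r *\<^sub>C x"
    and norm_scaleC: "norm (a *\<^sub>C x) = cmod a * norm x"

class complex_banach = complex_normed_vector + banach

global_interpretation complex_vector:
  vector_space "scaleC :: complex \<Rightarrow> 'a \<Rightarrow> 'a::complex_normed_vector"
proof
  show "1 *\<^sub>C x = x" for x :: 'a
    using scaleR_scaleC[of 1 x] by simp
qed (simp_all add: scaleC_add_right scaleC_add_left scaleC_scaleC)


section \<open>The dual space\<close>

typedef (overloaded) ('a::complex_normed_vector) cdual =
  "{f :: 'a \<Rightarrow>\<^sub>L complex. \<forall>c x. blinfun_apply f (c *\<^sub>C x) = c * blinfun_apply f x}"
  morphisms blinfun_of_cdual Cdual
  by (rule exI[of _ 0]) simp

setup_lifting type_definition_cdual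

lift_definition cdual_apply :: "'a::complex_normed_vector cdual \<Rightarrow> 'a \<Rightarrow> complex"
  is blinfun_apply .

text \<open>The norm below is the one of \<^typ>\<open>'a \<Rightarrow>\<^sub>L complex\<close>, that is, the operator norm.\<close>

instantiation cdual :: (complex_normed_vector) complex_normed_vector
begin

lift_definition zero_cdual :: "'a cdual" is 0 by simp
lift_definition plus_cdual :: "'a cdual \<Rightarrow> 'a cdual \<Rightarrow> 'a cdual" is "(+)"
  by (simp add: plus_blinfun.rep_eq algebra_simps)
lift_definition minus_cdual :: "'a cdual \<Rightarrow> 'a cdual \<Rightarrow> 'a cdual" is "(-)"
  by (simp add: minus_blinfun.rep_eq algebra_simps)
lift_definition uminus_cdual :: "'a cdual \<Rightarrow> 'a cdual" is uminus
  by (simp add: uminus_blinfun.rep_eq)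
lift_definition scaleR_cdual :: "real \<Rightarrow> 'a cdual \<Rightarrow> 'a cdual" is scaleR
  by (simp add: scaleR_blinfun.rep_eq)
lift_definition scaleC_cdual :: "complex \<Rightarrow> 'a cdual \<Rightarrow> 'a cdual"
  is "\<lambda>c f. blinfun_compose (blinfun_mult_right c) f"
  by simp
lift_definition norm_cdual :: "'a cdual \<Rightarrow> real" is norm .

definition dist_cdual :: "'a cdual \<Rightarrow> 'a cdual \<Rightarrow> real"
  where "dist_cdual f g = norm (f - g)"
definition sgn_cdual :: "'a cdual \<Rightarrow> 'a cdual"
  where "sgn_cdual f = inverse (norm f) *\<^sub>R f"
definition uniformity_cdual :: "('a cdual \<times> 'a cdual) filter"
  where "uniformity_cdual = (INF e\<in>{0 <..}. principal {(f, g). dist f g < e})"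
definition open_cdual :: "'a cdual set \<Rightarrow> bool"
  where "open_cdual U \<longleftrightarrow> (\<forall>f\<in>U. eventually (\<lambda>(f', g). f' = f \<longrightarrow> g \<in> U) uniformity)"

instance
proof
  fix f g h :: "'a cdual" and r s :: real and a b :: complex
  show "f + g + h = f + (g + h)" "f + g = g + f" "0 + f = f" "- f + f = 0" "f - g = f + - g"
    by (transfer, simp add: algebra_simps)+
  show "r *\<^sub>R (f + g) = r *\<^sub>R f + r *\<^sub>R g" "(r + s) *\<^sub>R f = r *\<^sub>R f + s *\<^sub>R f"
    "r *\<^sub>R s *\<^sub>R f = (r * s) *\<^sub>R f" "1 *\<^sub>R f = f"
    by (transfer, simp add: scaleR_add_right scaleR_add_left)+
  show "norm f = 0 \<longleftrightarrow> f = 0" "norm (f + g) \<le> norm f + norm g"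
    "norm (r *\<^sub>R f) = \<bar>r\<bar> * norm f"
    by (transfer, simp add: norm_triangle_ineq)+
  show "a *\<^sub>C (f + g) = a *\<^sub>C f + a *\<^sub>C g" "(a + b) *\<^sub>C f = a *\<^sub>C f + b *\<^sub>C f"
    "a *\<^sub>C b *\<^sub>C f = (a * b) *\<^sub>C f"
    by (transfer, rule blinfun_eqI, simp add: plus_blinfun.rep_eq algebra_simps)+
  show "r *\<^sub>R f = complex_of_real r *\<^sub>C f"
    by (transfer, rule blinfun_eqI, simp add: scaleR_blinfun.rep_eq scaleR_conv_of_real)
  show "norm (a *\<^sub>C f) = cmod a * norm f"
  proof transfer
    fix a :: complex and f :: "'a \<Rightarrow>\<^sub>L complex"
    have le: "norm (blinfun_compose (blinfun_mult_right c) g) \<le> cmod c * norm g"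
      for c and g :: "'a \<Rightarrow>\<^sub>L complex"
    proof (rule norm_blinfun_bound)
      show "cmod (blinfun_apply (blinfun_compose (blinfun_mult_right c) g) x)
          \<le> cmod c * norm g * norm x" for x
        using mult_left_mono[OF norm_blinfun[of g x], of "cmod c"] by (simp add: norm_mult mult.assoc)
    qed simp
    show "norm (blinfun_compose (blinfun_mult_right a) f) = cmod a * norm f"
    proof (cases "a = 0")
      case True
      then show ?thesis using le[of a f] by simp
    next
      case False
      have "blinfun_compose (blinfun_mult_right (inverse a))
          (blinfun_compose (blinfun_mult_right a) f) = f"
        by (rule blinfun_eqI) (simp add: False flip: mult.assoc)
      then have "norm f \<le> norm (blinfun_compose (blinfun_mult_right a) f) / cmod a"
        using le[of "inverse a" "blinfun_compose (blinfun_mult_right a) f"]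
        by (simp add: norm_inverse divide_inverse mult.commute)
      then have "cmod a * norm f \<le> norm (blinfun_compose (blinfun_mult_right a) f)"
        using False by (simp add: pos_le_divide_eq mult.commute)
      then show ?thesis using le[of a f] by simp
    qed
  qed
qed (simp_all add: dist_cdual_def sgn_cdual_def uniformity_cdual_def open_cdual_def)

end

instance cdual :: (complex_normed_vector) complex_banach
proof
  fix X :: "nat \<Rightarrow> 'a cdual"
  assume "Cauchy X"
  have dist_eq: "dist (blinfun_of_cdual f) (blinfun_of_cdual g) = dist f g" for f g :: "'a cdual"
    by (simp add: dist_norm norm_cdual.rep_eq minus_cdual.rep_eq)
  have "Cauchy (\<lambda>n. blinfun_of_cdual (X n))"
    using \<open>Cauchy X\<close> by (simp add: Cauchy_def dist_eq)
  then obtain L where L: "(\<lambda>n. blinfun_of_cdual (X n)) \<longlonglongrightarrow> L"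
    using Cauchy_convergent_iff convergent_def by blast
  have lim: "(\<lambda>n. blinfun_apply (blinfun_of_cdual (X n)) x) \<longlonglongrightarrow> blinfun_apply L x" for x
    using L by (intro tendsto_intros)
  have "blinfun_apply L (c *\<^sub>C x) = c * blinfun_apply L x" for c x
  proof (rule LIMSEQ_unique[OF lim])
    show "(\<lambda>n. blinfun_apply (blinfun_of_cdual (X n)) (c *\<^sub>C x)) \<longlonglongrightarrow> c * blinfun_apply L x"
      using tendsto_mult_left[OF lim, of c x] blinfun_of_cdual[of "X _"] by simp
  qed
  then have "blinfun_of_cdual (Cdual L) = L"
    by (simp add: Cdual_inverse)
  then have "X \<longlonglongrightarrow> Cdual L"
    using L dist_eq[of _ "Cdual L"] by (simp add: tendsto_iff)
  then show "convergent X"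
    by (auto simp: convergent_def)
qed


section \<open>Relative weak compactness\<close>

definition weak_topology :: "'a::complex_normed_vector topology"
  where "weak_topology = topology_generated_by {cdual_apply f -` U | f U. open U}"

definition relatively_weakly_compact :: "'a::complex_normed_vector set \<Rightarrow> bool"
  where "relatively_weakly_compact B \<longleftrightarrow> compactin weak_topology (weak_topology closure_of B)"


section \<open>Lindenstrauss--Pelczynski spaces\<close>

definition p_sum :: "real \<Rightarrow> nat \<Rightarrow> (nat \<Rightarrow> complex) \<Rightarrow> real"
  where "p_sum p n v = (\<Sum>i<n. cmod (v i) powr p) powr (1 / p)"

text \<open>The space $\ell^r_n$ is represented by the functions that vanish outside $\{0,\dots,n-1\}$.\<close>

definition ell_space :: "nat \<Rightarrow> (nat \<Rightarrow> complex) set"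
  where "ell_space n = {v. \<forall>i\<ge>n. v i = 0}"

definition ell_norm :: "ennreal \<Rightarrow> nat \<Rightarrow> (nat \<Rightarrow> complex) \<Rightarrow> real"
  where "ell_norm r n v =
    (if r = \<infinity> then Max (insert 0 ((\<lambda>i. cmod (v i)) ` {..<n})) else p_sum (enn2real r) n v)"

definition linear_iso_ell :: "'a::complex_normed_vector set \<Rightarrow> nat \<Rightarrow> ('a \<Rightarrow> nat \<Rightarrow> complex) \<Rightarrow> bool"
  where "linear_iso_ell N n T \<longleftrightarrow> bij_betw T N (ell_space n) \<and>
    (\<forall>x\<in>N. \<forall>y\<in>N. \<forall>a b. T (a *\<^sub>C x + b *\<^sub>C y) = (\<lambda>i. a * T x i + b * T y i))"

definition norm_to_ell ::
    "ennreal \<Rightarrow> 'a::complex_normed_vector set \<Rightarrow> nat \<Rightarrow> ('a \<Rightarrow> nat \<Rightarrow> complex) \<Rightarrow> ennreal"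
  where "norm_to_ell r N n T = (SUP x\<in>{x\<in>N. norm x \<le> 1}. ennreal (ell_norm r n (T x)))"

definition norm_from_ell ::
    "ennreal \<Rightarrow> nat \<Rightarrow> ((nat \<Rightarrow> complex) \<Rightarrow> 'a::complex_normed_vector) \<Rightarrow> ennreal"
  where "norm_from_ell r n S = (SUP v\<in>{v\<in>ell_space n. ell_norm r n v \<le> 1}. ennreal (norm (S v)))"

definition fin_dim_subspace :: "'a::complex_normed_vector set \<Rightarrow> bool"
  where "fin_dim_subspace M \<longleftrightarrow> (\<exists>A. finite A \<and> complex_vector.span A = M)"

text \<open>The parameter \<open>r\<close> is meant to range over $[1,\infty]$.\<close>

definition script_L_space :: "ennreal \<Rightarrow> 'a::complex_banach itself \<Rightarrow> bool"
  where "script_L_space r (_ :: 'a itself) \<longleftrightarrow>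
    (\<exists>C>1::real. \<forall>M::'a set. fin_dim_subspace M \<longrightarrow>
      (\<exists>N T. fin_dim_subspace N \<and> M \<subseteq> N \<and>
        linear_iso_ell N (complex_vector.dim N) T \<and>
        norm_to_ell r N (complex_vector.dim N) T *
          norm_from_ell r (complex_vector.dim N) (inv_into N T) \<le> ennreal C))"


section \<open>Multi-bounded sets\<close>

text \<open>An \<open>n\<close>-tuple is given by the values of a sequence at \<open>0, \<dots>, n - 1\<close>.\<close>

definition weak_summing_norm :: "real \<Rightarrow> nat \<Rightarrow> (nat \<Rightarrow> 'a::complex_normed_vector) \<Rightarrow> ennreal"
  where "weak_summing_norm p n x =
    (SUP f\<in>{f :: 'a cdual. norm f \<le> 1}. ennreal (p_sum p n (\<lambda>i. cdual_apply f (x i))))"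

definition multi_norm :: "real \<Rightarrow> real \<Rightarrow> nat \<Rightarrow> (nat \<Rightarrow> 'a::complex_normed_vector) \<Rightarrow> ennreal"
  where "multi_norm p q n x =
    (SUP f\<in>{f :: nat \<Rightarrow> 'a cdual. weak_summing_norm p n f \<le> 1}.
      ennreal (p_sum q n (\<lambda>j. cdual_apply (f j) (x j))))"

text \<open>By subadditivity in \<open>n\<close> of the \<open>q\<close>-th power of the supremum, the limit exists.\<close>

definition multi_bound_const :: "real \<Rightarrow> real \<Rightarrow> 'a::complex_normed_vector set \<Rightarrow> ennreal"
  where "multi_bound_const p q B =
    lim (\<lambda>n. SUP x\<in>{x. \<forall>i<n. x i \<in> B}. multi_norm p q n x / ennreal (real n powr (1 / q)))"

definition almost_multi_bounded :: "real \<Rightarrow> real \<Rightarrow> 'a::complex_normed_vector set \<Rightarrow> bool"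
  where "almost_multi_bounded p q B \<longleftrightarrow> multi_bound_const p q B = 0"

end

theory Submission
  imports Defs
begin

text \<open>Choosing a uniformly isomorphic copy of some \<open>\<ell>\<^sup>1\<^sub>n\<close> around every finite subset of \<open>E\<close> and passing to
  an ultrafilter lets one argue with the elements of \<open>E\<close> as with functions in \<open>L\<^sup>1(\<mu>)\<close>. There,
  both properties are equivalent to uniform integrability in the form: for every \<open>\<delta> > 0\<close>,
  some \<open>g\<close> satisfies \<open>\<integral>(\<bar>y\<bar> - g)\<^sup>+ \<le> \<delta>\<close> for all \<open>y \<in> B\<close>. If it fails, a greedy choice yields
  \<open>y\<^sub>j \<in> B\<close> and functionals \<open>\<phi>\<^sub>j\<close> given by signs on disjoint sets with \<open>\<bar>\<phi>\<^sub>j(y\<^sub>j)\<bar> \<ge> c\<close>; these have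
  weak \<open>1\<close>-summing norm at most \<open>1\<close>, which bounds the multi-norms from below, and a gliding
  hump excludes weak compactness. If it holds, \<open>B\<close> lies up to \<open>\<delta>\<close> in a ball of \<open>L\<^sup>2(g)\<close>, so
  that weak\<open>*\<close> cluster points in the bidual belong to \<open>E\<close>, and the multi-norms of \<open>n\<close>-tuples
  in \<open>B\<close> are \<open>o(n\<^sup>1\<^sup>/\<^sup>q)\<close>.\<close>

section \<open>Ultrafilters\<close>

text \<open>No measure space is ever formed. Relations such as additivity of the coordinates or a
  bound on the excess hold only for eventually all \<open>i\<close>, with a threshold depending on
  the elements involved. They can therefore be used for finitely many elements at a time, and
  infinite families survive only through functionals defined as limits along the ultrafilter. The
  ultrafilter serves twice: it makes these limits exist, and it turns the failure of an eventual
  upper bound into an eventual strict lower bound.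

  The exponents disappear for two reasons. Functionals carried by disjoint sets satisfy the summing
  condition for the exponent 1, the strongest one. Conversely, a tuple of functionals enters only
  through its values on the vectors \<open>e i t\<close>; for fixed \<open>t\<close> their p-th
  powers have a sum bounded independently of the length \<open>n\<close>, so the average of their
  moduli tends to 0. Boundedness of \<open>B\<close> then compares q-th powers with first
  powers.\<close>

lemma ultrafilter_below:
  fixes F :: "'i filter"
  assumes "F \<noteq> bot"
  obtains U where "U \<noteq> bot" "U \<le> F" "\<And>P. eventually P U \<or> eventually (\<lambda>i. \<not> P i) U"
proof -
  define A where "A = {G. G \<noteq> bot \<and> G \<le> F}"
  have "\<exists>m\<in>A. \<forall>a\<in>A. m \<ge> a \<longrightarrow> a = m"
  proof (rule predicate_Zorn)
    show "partial_order_on A (relation_of (\<ge>) A)"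
      by (rule partial_order_on_relation_ofI) auto
  next
    fix \<C> assume "\<C> \<in> Chains (relation_of (\<ge>) A)"
    then have sub: "\<C> \<subseteq> A" and tot: "\<And>G H. G \<in> \<C> \<Longrightarrow> H \<in> \<C> \<Longrightarrow> G \<le> H \<or> H \<le> G"
      by (auto simp: Chains_def relation_of_def)
    show "\<exists>u\<in>A. \<forall>a\<in>\<C>. a \<ge> u"
    proof (cases "\<C> = {}")
      case True
      then show ?thesis using assms by (auto simp: A_def)
    next
      case False
      \<comment> \<open>A chain is directed downwards, so whatever holds eventually for the infimum
        already does so for one member; in particular the infimum is not \<open>bot\<close>.\<close>
      have "eventually P (Inf \<C>) \<longleftrightarrow> (\<exists>b\<in>\<C>. eventually P b)" for P
      proof (rule eventually_Inf_base[OF False])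
        show "\<exists>x\<in>\<C>. x \<le> inf G H" if "G \<in> \<C>" "H \<in> \<C>" for G H
          using tot[OF that] that by auto
      qed
      then have "Inf \<C> \<noteq> bot"
        using sub by (auto simp: A_def trivial_limit_def)
      moreover have "Inf \<C> \<le> F"
        using False sub by (auto simp: A_def intro: Inf_lower2)
      ultimately show ?thesis
        by (auto simp: A_def intro: Inf_lower)
    qed
  qed
  then obtain U where U: "U \<noteq> bot" "U \<le> F" and min: "\<And>G. G \<noteq> bot \<Longrightarrow> G \<le> U \<Longrightarrow> G = U"
    unfolding A_def by (auto intro: order_trans)
  show thesis
  proof (rule that[OF U])
    fix P
    show "eventually P U \<or> eventually (\<lambda>i. \<not> P i) U"
    proof (cases "inf U (principal {i. P i}) = bot")
      case True
      then show ?thesis by (auto simp: trivial_limit_def eventually_inf_principal)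
    next
      case False
      then have "inf U (principal {i. P i}) = U" by (intro min) auto
      moreover have "eventually P (inf U (principal {i. P i}))"
        by (simp add: eventually_inf_principal)
      ultimately show ?thesis by simp
    qed
  qed
qed

text \<open>Compactness gives a cluster point, and an ultrafilter converges to each of its cluster
  points because it decides every neighbourhood.\<close>

lemma ultrafilter_convergent:
  assumes "U \<noteq> bot" and ultra: "\<And>P. eventually P U \<or> eventually (\<lambda>i. \<not> P i) U"
    and "compact K" "eventually (\<lambda>i. f i \<in> K) U"
  obtains l where "l \<in> K" "(f \<longlongrightarrow> l) U"
proof -
  have "filtermap f U \<noteq> bot" "eventually (\<lambda>x. x \<in> K) (filtermap f U)"
    using assms by (auto simp: filtermap_bot_iff eventually_filtermap)
  then obtain l where l: "l \<in> K" "inf (nhds l) (filtermap f U) \<noteq> bot"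
    using \<open>compact K\<close> unfolding compact_filter by blast
  have "eventually (\<lambda>i. f i \<in> S) U" if S: "open S" "l \<in> S" for S
  proof (rule ccontr)
    assume "\<not> eventually (\<lambda>i. f i \<in> S) U"
    then have "eventually (\<lambda>i. f i \<notin> S) U" using ultra by blast
    then have "eventually (\<lambda>_. False) (inf (nhds l) (filtermap f U))"
      unfolding eventually_inf using S
      by (intro exI[of _ "\<lambda>x. x \<in> S"] exI[of _ "\<lambda>x. x \<notin> S"])
        (auto simp: eventually_filtermap eventually_nhds)
    then show False using l(2) by (simp add: trivial_limit_def)
  qed
  then have "(f \<longlongrightarrow> l) U" by (simp add: tendsto_def)
  with l(1) show thesis by (rule that)
qed

section \<open>Functionals\<close>

lemma cdual_apply_add: "cdual_apply f (x + y) = cdual_apply f x + cdual_apply f y"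
  by transfer (simp add: blinfun.add_right)

lemma cdual_apply_diff: "cdual_apply f (x - y) = cdual_apply f x - cdual_apply f y"
  by transfer (simp add: blinfun.diff_right)

lemma cdual_apply_zero [simp]: "cdual_apply f 0 = 0"
  by transfer (simp add: blinfun.zero_right)

lemma cdual_apply_scaleC: "cdual_apply f (c *\<^sub>C x) = c * cdual_apply f x"
  by transfer simp

lemma cdual_apply_scaleR: "cdual_apply f (r *\<^sub>R x) = r *\<^sub>R cdual_apply f x"
  by (simp add: scaleR_scaleC cdual_apply_scaleC scaleR_conv_of_real)

lemma cdual_apply_sum: "cdual_apply f (\<Sum>i\<in>I. x i) = (\<Sum>i\<in>I. cdual_apply f (x i))"
  by (induction I rule: infinite_finite_induct) (simp_all add: cdual_apply_add)

lemma cdual_apply_add_left: "cdual_apply (f + g) x = cdual_apply f x + cdual_apply g x"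
  by transfer (simp add: plus_blinfun.rep_eq)

lemma cdual_apply_zero_left [simp]: "cdual_apply 0 x = 0"
  by transfer simp

lemma cdual_apply_scaleC_left: "cdual_apply (c *\<^sub>C f) x = c * cdual_apply f x"
  by transfer simp

lemma cdual_apply_sum_left: "cdual_apply (\<Sum>i\<in>I. f i) x = (\<Sum>i\<in>I. cdual_apply (f i) x)"
  by (induction I rule: infinite_finite_induct) (simp_all add: cdual_apply_add_left)

lemma norm_cdual_apply: "cmod (cdual_apply f x) \<le> norm f * norm x"
  by transfer (rule norm_blinfun)

lemma norm_cdual_apply': "cmod (cdual_apply f x) \<le> norm x * norm f"
  using norm_cdual_apply[of f x] by (simp only: mult.commute)

lemma norm_cdual_bound:
  assumes "0 \<le> b" "\<And>x. cmod (cdual_apply f x) \<le> b * norm x"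
  shows "norm f \<le> b"
  using assms by transfer (rule norm_blinfun_bound)

lemma cdual_of_function:
  fixes f :: "'a::complex_normed_vector \<Rightarrow> complex"
  assumes "\<And>x y. f (x + y) = f x + f y" "\<And>c x. f (c *\<^sub>C x) = c * f x" "\<And>x. cmod (f x) \<le> K * norm x"
  obtains g where "\<And>x. cdual_apply g x = f x"
proof -
  have "bounded_linear f"
    by (rule bounded_linear_intro[of _ K])
      (use assms in \<open>auto simp: scaleR_scaleC scaleR_conv_of_real mult.commute\<close>)
  then have "blinfun_apply (Blinfun f) = f" by (rule bounded_linear_Blinfun_apply)
  with assms(2) have "cdual_apply (Cdual (Blinfun f)) x = f x" for x
    by (simp add: cdual_apply_def Cdual_inverse)
  then show thesis by (rule that)
qed

lemma continuous_cdual_apply: "continuous_on UNIV (cdual_apply f)"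
proof -
  have "bounded_linear (cdual_apply f)" by transfer (rule blinfun.bounded_linear_right)
  then show ?thesis by (rule linear_continuous_on)
qed

definition eval_cdual :: "'a::complex_normed_vector \<Rightarrow> 'a cdual cdual"
  where "eval_cdual x = (SOME \<phi>. \<forall>f. cdual_apply \<phi> f = cdual_apply f x)"

lemma eval_cdual_apply [simp]: "cdual_apply (eval_cdual x) f = cdual_apply f x"
proof -
  obtain \<phi> where "\<And>f. cdual_apply \<phi> f = cdual_apply f x"
  proof (rule cdual_of_function)
    show "cdual_apply (f + g) x = cdual_apply f x + cdual_apply g x" for f g
      by (rule cdual_apply_add_left)
    show "cdual_apply (c *\<^sub>C f) x = c * cdual_apply f x" for c f
      by (rule cdual_apply_scaleC_left)
    show "cmod (cdual_apply f x) \<le> norm x * norm f" for f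
      by (rule norm_cdual_apply')
  qed blast
  then have "\<exists>\<phi>. \<forall>f. cdual_apply \<phi> f = cdual_apply f x" by (intro exI allI)
  from someI_ex[OF this] show ?thesis unfolding eval_cdual_def by (rule spec)
qed

lemma norm_eval_cdual_le: "norm (eval_cdual x) \<le> norm x"
  by (rule norm_cdual_bound) (simp_all add: norm_cdual_apply')

section \<open>Weak summing norms and multi-norms\<close>

lemma p_sum_le_iff:
  assumes "1 \<le> p" "0 \<le> c"
  shows "p_sum p n v \<le> c \<longleftrightarrow> (\<Sum>i<n. cmod (v i) powr p) \<le> c powr p"
proof -
  let ?S = "\<Sum>i<n. cmod (v i) powr p"
  have S: "0 \<le> ?S" by (intro sum_nonneg) auto
  then have "?S = (?S powr (1/p)) powr p" using assms by (simp add: powr_powr)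
  moreover have "a \<le> c \<longleftrightarrow> a powr p \<le> c powr p" if "0 \<le> a" for a
    using that assms by (meson less_le_not_le linorder_not_less order_less_le_trans powr_less_mono2 powr_mono2 zero_less_one)
  ultimately show ?thesis by (metis p_sum_def powr_ge_zero)
qed

lemma weak_summing_norm_le_1_iff:
  assumes "1 \<le> p"
  shows "weak_summing_norm p n x \<le> 1 \<longleftrightarrow>
    (\<forall>f. norm f \<le> 1 \<longrightarrow> (\<Sum>i<n. cmod (cdual_apply f (x i)) powr p) \<le> 1)"
  using p_sum_le_iff[OF assms, of 1]
  unfolding weak_summing_norm_def SUP_le_iff by (simp add: ennreal_le_1)

definition multi_sup :: "real \<Rightarrow> real \<Rightarrow> 'a::complex_normed_vector set \<Rightarrow> nat \<Rightarrow> ennreal"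
  where "multi_sup p q B n =
    (SUP x\<in>{x. \<forall>i<n. x i \<in> B}. multi_norm p q n x / ennreal (real n powr (1 / q)))"

text \<open>Removes suprema, roots and extended reals once and for all: after taking q-th powers the
  factor \<open>n powr (1 / q)\<close> becomes \<open>n\<close>, and all later estimates concern
  finite real sums.\<close>

lemma multi_sup_le_iff:
  fixes B :: "'a::complex_normed_vector set"
  assumes "1 \<le> q" "0 < n" "0 \<le> c"
  shows "multi_sup p q B n \<le> ennreal c \<longleftrightarrow>
    (\<forall>x f. (\<forall>i<n. x i \<in> B) \<longrightarrow> weak_summing_norm p n f \<le> 1 \<longrightarrow>
      (\<Sum>i<n. cmod (cdual_apply (f i) (x i)) powr q) \<le> c powr q * n)"
proof -
  have n: "0 < real n powr (1 / q)" using assms by simp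
  have div: "y / ennreal r \<le> ennreal c \<longleftrightarrow> y \<le> ennreal (c * r)" if r: "0 < r" for y r
  proof
    assume "y / ennreal r \<le> ennreal c"
    from mult_right_mono[OF this, of "ennreal r"] r assms(3) show "y \<le> ennreal (c * r)"
      by (simp add: ennreal_divide_times ennreal_mult)
  next
    assume "y \<le> ennreal (c * r)"
    then show "y / ennreal r \<le> ennreal c"
      using r assms(3) by (intro divide_le_posI_ennreal) (simp_all add: ennreal_mult mult.commute)
  qed
  have pow: "(c * real n powr (1 / q)) powr q = c powr q * n"
    using assms by (simp add: powr_mult powr_powr)
  have "multi_norm p q n x \<le> ennreal (c * real n powr (1 / q)) \<longleftrightarrow>
    (\<forall>f. weak_summing_norm p n f \<le> 1 \<longrightarrow>
      (\<Sum>i<n. cmod (cdual_apply (f i) (x i)) powr q) \<le> c powr q * n)"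
    for x :: "nat \<Rightarrow> 'a"
    using assms n p_sum_le_iff[OF assms(1), of "c * real n powr (1 / q)"]
    unfolding multi_norm_def SUP_le_iff pow by (simp add: ennreal_le_iff)
  then show ?thesis
    unfolding multi_sup_def SUP_le_iff div[OF n] by simp
qed

text \<open>Padding with zero functionals turns a block of at most \<open>m\<close> entries into an
  \<open>m\<close>-tuple. Passing to a subfamily does not increase the weak summing norm.\<close>

lemma multi_sup_window:
  fixes B :: "'a::complex_normed_vector set"
  assumes p: "1 \<le> p" and q: "1 \<le> q" and "0 \<le> c" and m: "multi_sup p q B m \<le> ennreal c"
    and "r \<le> m" "s + r \<le> n" and x: "\<forall>i<n. x i \<in> B" and f: "weak_summing_norm p n f \<le> 1"
  shows "(\<Sum>i\<in>{s..<s + r}. cmod (cdual_apply (f i) (x i)) powr q) \<le> c powr q * m"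
proof (cases "r = 0")
  case False
  \<comment> \<open>The padding of the points must lie in \<open>B\<close>. The entry
    \<open>x s\<close> does once \<open>r\<close> is positive; for an empty block \<open>s\<close>
    could be \<open>n\<close>, which is why \<open>r = 0\<close> is split off.\<close>
  define x' where "x' = (\<lambda>i. if i < r then x (s + i) else x s)"
  define f' where "f' = (\<lambda>i. if i < r then f (s + i) else 0)"
  have window: "(\<Sum>i<m. if i < r then g (s + i) else 0) = (\<Sum>i\<in>{s..<s+r}. g i)" for g :: "nat \<Rightarrow> real"
  proof -
    have "{..<m} \<inter> {i. i < r} = {0..<r}" using assms by auto
    then show ?thesis using sum.shift_bounds_nat_ivl[of g 0 s r]
      by (simp add: sum.If_cases add.commute)
  qed
  have "weak_summing_norm p m f' \<le> 1"
    unfolding weak_summing_norm_le_1_iff[OF p]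
  proof (intro allI impI)
    fix \<phi> :: "'a cdual cdual" assume \<phi>: "norm \<phi> \<le> 1"
    have "(\<Sum>i<m. cmod (cdual_apply \<phi> (f' i)) powr p)
      = (\<Sum>i<m. if i < r then cmod (cdual_apply \<phi> (f (s + i))) powr p else 0)"
      by (intro sum.cong) (auto simp: f'_def)
    also have "\<dots> = (\<Sum>i\<in>{s..<s+r}. cmod (cdual_apply \<phi> (f i)) powr p)"
      by (rule window)
    also have "\<dots> \<le> (\<Sum>i<n. cmod (cdual_apply \<phi> (f i)) powr p)"
      using \<open>s + r \<le> n\<close> by (intro sum_mono2) auto
    also have "\<dots> \<le> 1" using f \<phi> unfolding weak_summing_norm_le_1_iff[OF p] by blast
    finally show "(\<Sum>i<m. cmod (cdual_apply \<phi> (f' i)) powr p) \<le> 1" .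
  qed
  moreover have "\<forall>i<m. x' i \<in> B" using x False \<open>s + r \<le> n\<close> by (auto simp: x'_def)
  ultimately have "(\<Sum>i<m. cmod (cdual_apply (f' i) (x' i)) powr q) \<le> c powr q * m"
    using m False assms(5) multi_sup_le_iff[OF q _ \<open>0 \<le> c\<close>, of m p B] by simp
  also have "(\<Sum>i<m. cmod (cdual_apply (f' i) (x' i)) powr q)
      = (\<Sum>i<m. if i < r then cmod (cdual_apply (f (s + i)) (x (s + i))) powr q else 0)"
    by (intro sum.cong) (auto simp: f'_def x'_def)
  also have "\<dots> = (\<Sum>i\<in>{s..<s+r}. cmod (cdual_apply (f i) (x i)) powr q)"
    by (rule window)
  finally show ?thesis .
qed simp

text \<open>Cut the first \<open>s\<close> entries into blocks of length \<open>m\<close>, each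
  contributing at most \<open>c powr q * m\<close>. The extra summand \<open>m\<close> pays for the
  incomplete block.\<close>

lemma multi_sup_blocks:
  assumes "1 \<le> p" and "1 \<le> q" and "0 \<le> c" and "0 < m" and "multi_sup p q B m \<le> ennreal c"
    and x: "\<forall>i<n. x i \<in> B" and f: "weak_summing_norm p n f \<le> 1" and "s \<le> n"
  shows "(\<Sum>i<s. cmod (cdual_apply (f i) (x i)) powr q) \<le> c powr q * (s + m)"
  using \<open>s \<le> n\<close>
proof (induction s rule: less_induct)
  case (less s)
  note w = multi_sup_window[OF assms(1-3,5) _ _ x f]
  show ?case
  proof (cases "s \<le> m")
    case True
    have "(\<Sum>i\<in>{0..<0 + s}. cmod (cdual_apply (f i) (x i)) powr q) \<le> c powr q * m"
      using less.prems True by (intro w) auto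
    also have "\<dots> \<le> c powr q * (s + m)" by (intro mult_left_mono) auto
    finally show ?thesis by (simp add: atLeast0LessThan)
  next
    case False
    then have "{..<s} = {..<s - m} \<union> {s - m..<s - m + m}" by auto
    moreover have "{..<s - m} \<inter> {s - m..<s - m + m} = {}" by auto
    ultimately have "(\<Sum>i<s. cmod (cdual_apply (f i) (x i)) powr q) =
      (\<Sum>i<s - m. cmod (cdual_apply (f i) (x i)) powr q)
      + (\<Sum>i\<in>{s - m..<s - m + m}. cmod (cdual_apply (f i) (x i)) powr q)"
      by (simp add: sum.union_disjoint)
    also have "\<dots> \<le> c powr q * (real (s - m) + m) + c powr q * m"
      using False less.prems \<open>0 < m\<close> less.IH[of "s - m"] w[of m "s - m"] by fastforce
    also have "\<dots> = c powr q * (s + m)" using False by (simp add: algebra_simps of_nat_diff)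
    finally show ?thesis by simp
  qed
qed

text \<open>A subadditivity argument in the style of Fekete: a bound at one length \<open>m\<close>
  passes to all large \<open>n\<close> with a relative error of order \<open>m / n\<close>. The
  length 0 is left out of the infimum because its term is 0 / 0, which is 0 in
  \<open>ennreal\<close>.\<close>

lemma multi_sup_tendsto:
  fixes B :: "'a::complex_normed_vector set"
  assumes p: "1 \<le> p" and q: "1 \<le> q"
  shows "multi_sup p q B \<longlonglongrightarrow> (INF n\<in>{0<..}. multi_sup p q B n)"
proof (rule order_tendstoI)
  fix a assume "a < (INF n\<in>{0<..}. multi_sup p q B n)"
  then have "a < multi_sup p q B n" if "0 < n" for n
    using that by (meson INF_lower greaterThan_iff less_le_trans)
  then show "eventually (\<lambda>n. a < multi_sup p q B n) sequentially"
    using eventually_gt_at_top[of 0] by (rule eventually_mono[rotated])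
next
  fix a assume "(INF n\<in>{0<..}. multi_sup p q B n) < a"
  then obtain m where m: "0 < m" "multi_sup p q B m < a" by (auto simp: INF_less_iff)
  obtain b where b: "multi_sup p q B m < b" "b < a" using dense[OF m(2)] by blast
  define c where "c = enn2real b"
  have bc: "b = ennreal c" "0 \<le> c" using b(2) by (auto simp: c_def intro!: ennreal_enn2real[symmetric] elim: order_less_le_trans)
  obtain b' where b': "b < b'" "b' < a" using dense[OF b(2)] by blast
  define d where "d = enn2real b'"
  have "b' = ennreal d" "0 \<le> d" using b'(2) by (auto simp: d_def intro!: ennreal_enn2real[symmetric] elim: order_less_le_trans)
  then have d: "c < d" "ennreal d < a" using b' bc by (auto simp: ennreal_less_iff)
  \<comment> \<open>The gap between \<open>c\<close> and \<open>d\<close> absorbs the surplus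
    \<open>c powr q * m\<close> of the block estimate as soon as \<open>n\<close> is large.\<close>
  have "c powr q < d powr q" using d bc q by (intro powr_less_mono2) auto
  then have "0 < d powr q - c powr q" by simp
  then have "eventually (\<lambda>n. c powr q * m / (d powr q - c powr q) \<le> real n) sequentially"
    using filterlim_real_sequentially filterlim_at_top by blast
  then show "eventually (\<lambda>n. multi_sup p q B n < a) sequentially"
    using eventually_gt_at_top[of 0]
  proof eventually_elim
    case (elim n)
    have "multi_sup p q B n \<le> ennreal d"
    proof (subst multi_sup_le_iff, goal_cases)
      case 4
      show ?case
      proof (intro allI impI)
        fix x :: "nat \<Rightarrow> 'a" and f :: "nat \<Rightarrow> 'a cdual" assume xf: "\<forall>i<n. x i \<in> B" "weak_summing_norm p n f \<le> 1"
        have "(\<Sum>i<n. cmod (cdual_apply (f i) (x i)) powr q) \<le> c powr q * (n + m)"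
          by (rule multi_sup_blocks[OF p q bc(2) m(1) _ xf order_refl]) (use b bc in auto)
        also have "\<dots> \<le> d powr q * n"
          using elim \<open>0 < d powr q - c powr q\<close> by (simp add: field_simps)
        finally show "(\<Sum>i<n. cmod (cdual_apply (f i) (x i)) powr q) \<le> d powr q * n" .
      qed
    qed (use q elim d bc in auto)
    then show ?case using d(2) by simp
  qed
qed

text \<open>\<open>lim\<close> is a definite description, so its value carries information only once
  convergence has been proved.\<close>

lemma almost_multi_bounded_iff_tendsto:
  assumes "1 \<le> p" and "1 \<le> q"
  shows "almost_multi_bounded p q B \<longleftrightarrow> multi_sup p q B \<longlonglongrightarrow> 0"
proof -
  have "multi_bound_const p q B = lim (multi_sup p q B)"
    by (simp add: multi_bound_const_def multi_sup_def[abs_def])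
  then show ?thesis
    using multi_sup_tendsto[OF assms, of B] unfolding almost_multi_bounded_def by (metis limI)
qed

section \<open>The weak topology\<close>

lemma topspace_weak_topology [simp]: "topspace (weak_topology :: 'a::complex_normed_vector topology) = UNIV"
proof -
  have "(UNIV :: 'a set) = cdual_apply 0 -` UNIV" by simp
  then show ?thesis unfolding weak_topology_def by auto
qed

lemma openin_weak_vimage: "open U \<Longrightarrow> openin weak_topology (cdual_apply f -` U)"
  unfolding weak_topology_def by (rule topology_generated_by_Basis) blast

lemma openin_weak_ball:
  assumes "finite A"
  shows "openin weak_topology {x. \<forall>f\<in>A. cmod (cdual_apply f x - c f) < \<epsilon>}"
proof -
  have "openin weak_topology (\<Inter>f\<in>A. cdual_apply f -` ball (c f) \<epsilon>)" if "A \<noteq> {}"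
    using assms that by (intro openin_Inter) (auto intro: openin_weak_vimage)
  moreover have "(\<Inter>f\<in>A. cdual_apply f -` ball (c f) \<epsilon>) = {x. \<forall>f\<in>A. cmod (cdual_apply f x - c f) < \<epsilon>}"
    by (auto simp: dist_norm norm_minus_commute)
  ultimately show ?thesis
    using openin_topspace[of weak_topology] by (cases "A = {}") auto
qed

lemma subset_weak_closure: "B \<subseteq> weak_topology closure_of B"
  by (rule closure_of_subset) simp

text \<open>Otherwise every point has a weak neighbourhood that the sequence eventually leaves, and
  finitely many of these cover the weak closure. A cluster point, rather than a convergent
  subsequence, is all that is used later; \<open>\<exists>\<^sub>F\<close> lets it be combined with
  conditions that hold eventually.\<close>

lemma rwc_cluster_point:
  fixes B :: "'a::complex_normed_vector set"
  assumes "relatively_weakly_compact B" and y: "\<And>n. y n \<in> B"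
  obtains z where "\<forall>A \<epsilon>. finite A \<longrightarrow> 0 < \<epsilon> \<longrightarrow>
    (\<exists>\<^sub>F n in sequentially. \<forall>f\<in>A. cmod (cdual_apply f (y n) - cdual_apply f z) < \<epsilon>)"
proof -
  let ?K = "weak_topology closure_of B"
  have "\<exists>z. \<forall>W. openin weak_topology W \<longrightarrow> z \<in> W \<longrightarrow> (\<exists>\<^sub>F n in sequentially. y n \<in> W)"
  proof (rule ccontr)
    assume "\<not> ?thesis"
    then have "\<forall>z. \<exists>W. openin weak_topology W \<and> z \<in> W \<and> eventually (\<lambda>n. y n \<notin> W) sequentially"
      by (simp add: not_frequently)
    then obtain W where W: "\<And>z. openin weak_topology (W z)" "\<And>z. z \<in> W z"
      "\<And>z. eventually (\<lambda>n. y n \<notin> W z) sequentially"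
      by metis
    have "compactin weak_topology ?K"
      using assms(1) by (simp add: relatively_weakly_compact_def)
    then obtain \<F> where \<F>: "finite \<F>" "\<F> \<subseteq> range W" "?K \<subseteq> \<Union>\<F>"
      using compactinD[of weak_topology ?K "range W"] W(1,2) by blast
    then obtain Z where "finite Z" and Z: "\<F> = W ` Z"
      using finite_subset_image by metis
    have "eventually (\<lambda>n. \<forall>z\<in>Z. y n \<notin> W z) sequentially"
      using \<open>finite Z\<close> W(3) by (simp add: eventually_ball_finite)
    then have "eventually (\<lambda>n. y n \<notin> ?K) sequentially"
      by eventually_elim (use Z \<F>(3) in auto)
    then show False
      using y subset_weak_closure[of B] by (auto simp: subset_iff)
  qed
  then obtain z where z: "\<And>W. openin weak_topology W \<Longrightarrow> z \<in> W \<Longrightarrow> \<exists>\<^sub>F n in sequentially. y n \<in> W"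
    by blast
  show thesis
  proof (rule that, intro allI impI)
    fix A :: "'a cdual set" and \<epsilon> :: real assume "finite A" "0 < \<epsilon>"
    then show "\<exists>\<^sub>F n in sequentially. \<forall>f\<in>A. cmod (cdual_apply f (y n) - cdual_apply f z) < \<epsilon>"
      using z[OF openin_weak_ball[of A "\<lambda>f. cdual_apply f z" \<epsilon>]] by simp
  qed
qed

section \<open>Boundedness of weakly bounded families\<close>

lemma rwc_weakly_bounded:
  assumes "relatively_weakly_compact B"
  shows "bounded (cdual_apply f ` B)"
proof -
  have "continuous_map weak_topology euclidean (cdual_apply f)"
    using openin_weak_vimage[of _ f] by (simp add: continuous_map_def vimage_def)
  then have "compactin euclidean (cdual_apply f ` (weak_topology closure_of B))"
    using assms unfolding relatively_weakly_compact_def by (rule image_compactin[rotated])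
  then have "bounded (cdual_apply f ` (weak_topology closure_of B))"
    by (simp add: compact_imp_bounded)
  then show ?thesis
    by (rule bounded_subset) (intro image_mono subset_weak_closure)
qed

text \<open>Banach-Steinhaus by Baire category: the open sets \<open>G n\<close> have empty
  intersection, so one of them is not dense, and on a ball that misses it all functionals are
  bounded by \<open>n\<close>.\<close>

lemma uniform_boundedness:
  fixes \<Phi> :: "'a::complex_banach cdual set"
  assumes "\<And>x. bounded ((\<lambda>\<phi>. cdual_apply \<phi> x) ` \<Phi>)"
  shows "bounded \<Phi>"
proof -
  define G where "G n = (\<Union>\<phi>\<in>\<Phi>. {x. real n < cmod (cdual_apply \<phi> x)})" for n
  have open_G: "open (G n)" for n
  proof -
    have "open {x. real n < cmod (cdual_apply \<phi> x)}" for \<phi> :: "'a cdual"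
      using continuous_cdual_apply[of \<phi>] by (intro open_Collect_less continuous_intros)
    then show ?thesis by (auto simp: G_def)
  qed
  have empty: "\<Inter>(range G) = {}"
  proof safe
    fix x assume x: "x \<in> \<Inter>(range G)"
    obtain b where "\<forall>\<phi>\<in>\<Phi>. cmod (cdual_apply \<phi> x) \<le> b"
      using assms[of x] by (auto simp: bounded_iff)
    moreover obtain n where "b < real n" using reals_Archimedean2 by blast
    moreover obtain \<phi> where "\<phi> \<in> \<Phi>" "real n < cmod (cdual_apply \<phi> x)"
      using x by (auto simp: G_def)
    ultimately show "x \<in> {}" by fastforce
  qed
  have "\<exists>n. closure (G n) \<noteq> UNIV"
  proof (rule ccontr)
    assume dense: "\<not> ?thesis"
    have "Met_TC.mtopology closure_of \<Inter>(range G) = (UNIV :: 'a set)"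
    proof (rule Met_TC.metric_Baire_category)
      show "Met_TC.mcomplete TYPE('a)"
        by (simp add: complete_UNIV)
    qed (use open_G dense in auto)
    then show False using empty by simp
  qed
  then obtain n x0 where "x0 \<notin> closure (G n)" by blast
  moreover have "open (- closure (G n))" by (simp add: open_Compl)
  ultimately obtain r where "0 < r" "ball x0 r \<subseteq> - closure (G n)"
    unfolding open_contains_ball by blast
  then have r: "0 < r" "ball x0 r \<inter> G n = {}"
    using closure_subset[of "G n"] by auto
  have small: "cmod (cdual_apply \<phi> x) \<le> n" if "\<phi> \<in> \<Phi>" "dist x0 x < r" for \<phi> x
  proof -
    have "x \<notin> G n" using r(2) that(2) by auto
    then show ?thesis using that(1) by (auto simp: G_def not_less)
  qed
  have "norm \<phi> \<le> 4 * n / r" if "\<phi> \<in> \<Phi>" for \<phi>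
  proof (rule norm_cdual_bound)
    fix x
    show "cmod (cdual_apply \<phi> x) \<le> 4 * n / r * norm x"
    proof (cases "x = 0")
      case False
      \<comment> \<open>The step \<open>s\<close> keeps \<open>x0 + s *\<^sub>R x\<close> inside the
        ball. The difference of two values bounded by \<open>n\<close> then gives
        \<open>2 * n / s\<close>, whence the constant \<open>4 * n / r\<close>.\<close>
      define s where "s = r / (2 * norm x)"
      have s: "0 < s" using False r by (simp add: s_def)
      have "dist x0 (x0 + s *\<^sub>R x) < r" using False r by (simp add: s_def dist_norm)
      then have "cmod (cdual_apply \<phi> (x0 + s *\<^sub>R x)) \<le> n" "cmod (cdual_apply \<phi> x0) \<le> n"
        using small that r by auto
      moreover have "s *\<^sub>R cdual_apply \<phi> x = cdual_apply \<phi> (x0 + s *\<^sub>R x) - cdual_apply \<phi> x0"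
        by (simp add: cdual_apply_add cdual_apply_scaleR)
      ultimately have "cmod (s *\<^sub>R cdual_apply \<phi> x) \<le> real n + real n"
        using norm_triangle_ineq4[of "cdual_apply \<phi> (x0 + s *\<^sub>R x)" "cdual_apply \<phi> x0"] by simp
      then have "s * cmod (cdual_apply \<phi> x) \<le> 2 * n" using s by simp
      then show ?thesis using r False by (simp add: s_def field_simps)
    qed simp
  qed (use r in simp)
  then show ?thesis unfolding bounded_iff by blast
qed

section \<open>Weakly unconditionally Cauchy series and weak compactness\<close>

text \<open>The functionals \<open>\<phi>\<^sub>j\<close> form a weakly unconditionally Cauchy series. After passing to a
  subsequence the matrix \<open>\<phi>\<^sub>i(y\<^sub>k)\<close> is nearly diagonal, so the tails of the series of
  functionals stay away from \<open>0\<close> on the \<open>y\<^sub>k\<close> but tend to \<open>0\<close> at a weak cluster point.\<close>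

lemma rwc_no_wuC_lower_bound:
  fixes B :: "'a::complex_normed_vector set" and y :: "nat \<Rightarrow> 'a" and \<phi> :: "nat \<Rightarrow> 'a cdual"
  assumes rwc: "relatively_weakly_compact B" and y: "\<And>j. y j \<in> B"
    and sum: "\<And>n x. (\<Sum>j<n. cmod (cdual_apply (\<phi> j) x)) \<le> norm x"
    and "0 < c" and lower: "\<And>j. c \<le> cmod (cdual_apply (\<phi> j) (y j))"
  shows False
proof -
  have summable: "summable (\<lambda>j. cmod (cdual_apply (\<phi> j) x))" for x
    by (rule summableI_nonneg_bounded[of _ "norm x"]) (use sum in auto)
  have to0: "(\<lambda>j. cmod (cdual_apply (\<phi> j) x)) \<longlonglongrightarrow> 0" for x
    using summable by (rule summable_LIMSEQ_zero)
  obtain z where z: "\<forall>A \<epsilon>. finite A \<longrightarrow> 0 < \<epsilon> \<longrightarrow>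
    (\<exists>\<^sub>F n in sequentially. \<forall>f\<in>A. cmod (cdual_apply f (y n) - cdual_apply f z) < \<epsilon>)"
    by (rule rwc_cluster_point[OF rwc, of y, OF y])
  \<comment> \<open>The factor 1/32 makes the off-diagonal bounds \<open>2 * \<eta> i\<close> add up
    to \<open>c / 8\<close>.\<close>
  define \<eta> where "\<eta> k = c * (1/2)^k / 32" for k
  have \<eta>_pos: "0 < \<eta> k" for k using \<open>0 < c\<close> by (simp add: \<eta>_def)
  have \<eta>_mono: "\<eta> k \<le> \<eta> i" if "i \<le> k" for i k
    using \<open>0 < c\<close> that by (simp add: \<eta>_def power_decreasing)
  \<comment> \<open>Conditions on the next index \<open>r\<close>. The new functional is small at
    \<open>z\<close> and at the points chosen before, which holds eventually since \<phi>_r tends to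
    0 pointwise. The new point looks like \<open>z\<close> to the functionals chosen before, which
    holds frequently since \<open>z\<close> is a cluster point.\<close>
  define P where "P s k r \<longleftrightarrow> (\<forall>i<k. s i < r) \<and> cmod (cdual_apply (\<phi> r) z) < \<eta> k \<and>
    (\<forall>i<k. cmod (cdual_apply (\<phi> r) (y (s i))) < \<eta> k) \<and>
    (\<forall>i<k. cmod (cdual_apply (\<phi> (s i)) (y r) - cdual_apply (\<phi> (s i)) z) < \<eta> k)"
    for s :: "nat \<Rightarrow> nat" and k r
  have step: "\<exists>\<^sub>F r in sequentially. P s k r"
    if "\<exists>\<^sub>F r in sequentially. \<forall>f\<in>(\<lambda>i. \<phi> (s i)) ` {..<k}. cmod (cdual_apply f (y r) - cdual_apply f z) < \<eta> k"
      "eventually (\<lambda>r. \<forall>i\<in>{..<k}. s i < r) sequentially"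
      "eventually (\<lambda>r. cmod (cdual_apply (\<phi> r) z) < \<eta> k) sequentially"
      "eventually (\<lambda>r. \<forall>i\<in>{..<k}. cmod (cdual_apply (\<phi> r) (y (s i))) < \<eta> k) sequentially" for s k
    using frequently_eventually_frequently[OF that(1) eventually_conj[OF that(2) eventually_conj[OF that(3,4)]]]
    by (rule frequently_elim1) (simp add: P_def)
  have "\<exists>s. \<forall>k. P s k (s k)"
  proof (rule dependent_wellorder_choice)
    show "P s k r = P s' k r" if "\<And>i. i < k \<Longrightarrow> s i = s' i" for s s' k r
      using that by (simp add: P_def)
  next
    fix k s
    have "\<exists>\<^sub>F r in sequentially. \<forall>f\<in>(\<lambda>i. \<phi> (s i)) ` {..<k}. cmod (cdual_apply f (y r) - cdual_apply f z) < \<eta> k"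
      using \<eta>_pos by (intro z[rule_format]) auto
    moreover have "eventually (\<lambda>r. \<forall>i\<in>{..<k}. s i < r) sequentially"
      by (intro eventually_ball_finite) (auto intro: eventually_gt_at_top)
    moreover have "eventually (\<lambda>r. cmod (cdual_apply (\<phi> r) z) < \<eta> k) sequentially"
      using order_tendstoD(2)[OF to0 \<eta>_pos] .
    moreover have "eventually (\<lambda>r. \<forall>i\<in>{..<k}. cmod (cdual_apply (\<phi> r) (y (s i))) < \<eta> k) sequentially"
      using order_tendstoD(2)[OF to0 \<eta>_pos] by (intro eventually_ball_finite) auto
    ultimately have "\<exists>\<^sub>F r in sequentially. P s k r"
      by (rule step)
    then show "\<exists>r. P s k r" by (rule frequently_ex)
  qed
  then obtain s where s: "\<And>k. P s k (s k)" by blast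
  have "strict_mono s"
    using s by (auto simp: P_def strict_mono_def)
  \<comment> \<open>Below the diagonal the bound was imposed directly. Above it, the value at
    \<open>y (s k)\<close> is compared with the value at \<open>z\<close>, which was made small when
    \<open>s i\<close> was chosen.\<close>
  have off: "cmod (cdual_apply (\<phi> (s i)) (y (s k))) \<le> 2 * \<eta> i" if "i \<noteq> k" for i k
  proof (cases "k < i")
    case True
    then show ?thesis using s[of i] \<eta>_pos[of i] by (auto simp: P_def intro: less_imp_le order_less_le_trans)
  next
    case False
    then have "i < k" using that by simp
    then have "cmod (cdual_apply (\<phi> (s i)) (y (s k)) - cdual_apply (\<phi> (s i)) z) < \<eta> k"
      using s[of k] by (simp add: P_def)
    moreover have "cmod (cdual_apply (\<phi> (s i)) z) < \<eta> i" using s[of i] by (simp add: P_def)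
    moreover note \<eta>_mono[of i k] \<open>i < k\<close>
    ultimately show ?thesis
      using norm_triangle_sub[of "cdual_apply (\<phi> (s i)) (y (s k))" "cdual_apply (\<phi> (s i)) z"] by simp
  qed
  have tail_summable: "summable (\<lambda>i. cmod (cdual_apply (\<phi> (s (i + n))) x))" for n x
  proof -
    have "summable (\<lambda>i. cmod (cdual_apply (\<phi> (s i)) x))"
      using summable_reindex[OF summable[of x], of s] \<open>strict_mono s\<close>
      by (simp add: strict_mono_imp_inj_on comp_def)
    then show ?thesis by (subst summable_iff_shift)
  qed
  define T where "T n x = (\<Sum>i. cdual_apply (\<phi> (s (i + n))) x)" for n x
  have sm: "summable (\<lambda>i. cdual_apply (\<phi> (s (i + n))) x)" for n x
    using tail_summable by (rule summable_norm_cancel)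
  have "\<exists>f. \<forall>x. cdual_apply f x = T n x" for n
  proof -
    obtain f where "\<And>x. cdual_apply f x = T n x"
    proof (rule cdual_of_function[of "T n" 1])
      show "T n (x + y) = T n x + T n y" for x y
        unfolding T_def cdual_apply_add using sm sm by (rule suminf_add[symmetric])
      show "T n (a *\<^sub>C x) = a * T n x" for a x
        unfolding T_def cdual_apply_scaleC using sm by (rule suminf_mult)
      show "cmod (T n x) \<le> 1 * norm x" for x
      proof -
        have "cmod (T n x) \<le> (\<Sum>i. cmod (cdual_apply (\<phi> (s (i + n))) x))"
          unfolding T_def by (rule summable_norm[OF tail_summable])
        also have "\<dots> \<le> norm x"
        proof (rule suminf_le_const[OF tail_summable])
          fix N
          have "(\<Sum>i<N. cmod (cdual_apply (\<phi> (s (i + n))) x))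
            = (\<Sum>j\<in>(\<lambda>i. s (i + n)) ` {..<N}. cmod (cdual_apply (\<phi> j) x))"
            using \<open>strict_mono s\<close> by (subst sum.reindex) (auto simp: inj_on_def strict_mono_eq)
          also have "\<dots> \<le> (\<Sum>j<s (N + n). cmod (cdual_apply (\<phi> j) x))"
            using \<open>strict_mono s\<close> by (intro sum_mono2) (auto simp: strict_mono_less)
          also have "\<dots> \<le> norm x" by (rule sum)
          finally show "(\<Sum>i<N. cmod (cdual_apply (\<phi> (s (i + n))) x)) \<le> norm x" .
        qed
        finally show ?thesis by simp
      qed
    qed blast
    then show ?thesis by blast
  qed
  then obtain f where f: "\<And>n x. cdual_apply (f n) x = T n x" by metis
  \<comment> \<open>For \<open>n \<le> k\<close> the tail contains the diagonal term, of modulus at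
    least \<open>c\<close>; all other terms together contribute at most
    \<open>c / 8\<close>.\<close>
  have big: "c / 2 \<le> cmod (T n (y (s k)))" if "n \<le> k" for n k
  proof -
    let ?a = "\<lambda>i. cdual_apply (\<phi> (s (i + n))) (y (s k))"
    let ?d = "\<lambda>i. if i = k - n then cdual_apply (\<phi> (s k)) (y (s k)) else 0"
    have "?d sums cdual_apply (\<phi> (s k)) (y (s k))"
      by (rule sums_single)
    then have "(\<lambda>i. ?a i - ?d i) sums (T n (y (s k)) - cdual_apply (\<phi> (s k)) (y (s k)))"
      unfolding T_def using sm by (intro sums_diff summable_sums)
    moreover have "(\<lambda>i. c * (1/2)^i / 16) sums (c / 8)"
      using sums_mult[OF geometric_sums[of "1/2::real"], of "c/16"] by (simp add: field_simps)
    moreover have "cmod (?a i - ?d i) \<le> c * (1/2)^i / 16" for i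
    proof (cases "i = k - n")
      case False
      then have "i + n \<noteq> k" using that by auto
      then have "cmod (?a i) \<le> 2 * \<eta> (i + n)" by (rule off)
      also have "\<dots> \<le> 2 * \<eta> i" using \<eta>_mono[of i "i + n"] by simp
      finally show ?thesis using False by (simp add: \<eta>_def)
    qed (use that \<open>0 < c\<close> in simp)
    ultimately have "cmod (T n (y (s k)) - cdual_apply (\<phi> (s k)) (y (s k))) \<le> c / 8"
      by (metis (no_types, lifting) norm_suminf_le sums_iff)
    moreover have "c \<le> cmod (cdual_apply (\<phi> (s k)) (y (s k)))" by (rule lower)
    ultimately show ?thesis
      using norm_triangle_sub[of "cdual_apply (\<phi> (s k)) (y (s k))" "T n (y (s k))"] \<open>0 < c\<close>
      by (simp add: norm_minus_commute)
  qed
  \<comment> \<open>The subsequence need not cluster at \<open>z\<close>, so a new cluster point is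
    taken. There every tail has modulus at least \<open>c / 4\<close>, although the series converges
    absolutely.\<close>
  obtain w where w: "\<forall>A \<epsilon>. finite A \<longrightarrow> 0 < \<epsilon> \<longrightarrow>
    (\<exists>\<^sub>F k in sequentially. \<forall>f\<in>A. cmod (cdual_apply f (y (s k)) - cdual_apply f w) < \<epsilon>)"
    by (rule rwc_cluster_point[OF rwc, of "\<lambda>k. y (s k)", OF y])
  have lim_big: "c / 4 \<le> cmod (T n w)" for n
  proof -
    have "\<exists>\<^sub>F k in sequentially. cmod (T n (y (s k)) - T n w) < c / 4"
      using w[rule_format, of "{f n}" "c / 4"] \<open>0 < c\<close> by (simp add: f)
    then have "\<exists>\<^sub>F k in sequentially. cmod (T n (y (s k)) - T n w) < c / 4 \<and> n \<le> k"
      using eventually_ge_at_top[of n] by (rule frequently_eventually_frequently)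
    then obtain k where k: "cmod (T n (y (s k)) - T n w) < c / 4" "n \<le> k"
      using frequently_ex by fastforce
    then show ?thesis
      using big[OF k(2)] norm_triangle_sub[of "T n (y (s k))" "T n w"] by simp
  qed
  obtain n where "norm (\<Sum>i. cmod (cdual_apply (\<phi> (s (i + n))) w)) < c / 4"
    using suminf_exist_split[OF _ tail_summable[of 0 w], of "c / 4"] \<open>0 < c\<close> by auto
  moreover have "cmod (T n w) \<le> (\<Sum>i. cmod (cdual_apply (\<phi> (s (i + n))) w))"
    unfolding T_def by (rule summable_norm[OF tail_summable])
  ultimately show False using lim_big[of n] by simp
qed

section \<open>A criterion for relative weak compactness\<close>

text \<open>Transports open covers to the product space of all functions on the dual, where
  Tychonoff's theorem is available.\<close>

lemma openin_weak_topologyD: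
  assumes "openin weak_topology W"
  shows "\<exists>V. open V \<and> W = (\<lambda>x f. cdual_apply f x) -` V"
proof -
  let ?S = "{cdual_apply f -` U | f U. open U}"
  have "generate_topology_on ?S W"
    using assms unfolding weak_topology_def by (rule openin_topology_generated_by)
  then show ?thesis
  proof induction
    case Empty
    then show ?case by (intro exI[of _ "{}"]) simp
  next
    case (Int a b)
    then obtain V V' where "open V" "a = (\<lambda>x f. cdual_apply f x) -` V"
      "open V'" "b = (\<lambda>x f. cdual_apply f x) -` V'" by blast
    then show ?case by (intro exI[of _ "V \<inter> V'"]) auto
  next
    case (UN K)
    then obtain V where "\<And>k. k \<in> K \<Longrightarrow> open (V k) \<and> k = (\<lambda>x f. cdual_apply f x) -` V k"
      by metis
    then show ?case by (intro exI[of _ "\<Union>(V ` K)"]) auto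
  next
    case (Basis s)
    then obtain f U where s: "open U" "s = cdual_apply f -` U" by blast
    have "open ((\<lambda>F. F f) -` U)"
      using continuous_on_product_coordinates[of f] s(1) by (rule open_vimage[rotated])
    then show ?case using s(2) by (intro exI[of _ "(\<lambda>F. F f) -` U"]) auto
  qed
qed

text \<open>Here \<open>F\<close> ranges over the weak\<open>*\<close>-closure of \<open>B\<close> in the bidual of \<open>'a\<close>.\<close>

lemma relatively_weakly_compactI:
  fixes B :: "'a::complex_normed_vector set"
  assumes bounded: "\<And>x. x \<in> B \<Longrightarrow> norm x \<le> K"
    and repr: "\<And>F. (\<And>A \<epsilon>. finite A \<Longrightarrow> 0 < \<epsilon> \<Longrightarrow> \<exists>y\<in>B. \<forall>f\<in>A. cmod (cdual_apply f y - F f) < \<epsilon>)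
      \<Longrightarrow> \<exists>z. \<forall>f. F f = cdual_apply f z"
  shows "relatively_weakly_compact B"
proof -
  define ev :: "'a \<Rightarrow> 'a cdual \<Rightarrow> complex" where "ev x f = cdual_apply f x" for x f
  have ev_alt: "ev = (\<lambda>x f. cdual_apply f x)" by (simp add: ev_def fun_eq_iff)
  \<comment> \<open>As in the Banach-Alaoglu theorem, a bounded set embeds in a product of closed
    discs; the closure of its image is compact there.\<close>
  have "compactin (product_topology (\<lambda>_. euclidean) UNIV) (PiE UNIV (\<lambda>f::'a cdual. cball (0::complex) (norm f * K)))"
    by (simp add: compactin_PiE)
  then have "compact (PiE UNIV (\<lambda>f::'a cdual. cball (0::complex) (norm f * K)))"
    by (simp add: euclidean_product_topology)
  moreover have "ev ` B \<subseteq> PiE UNIV (\<lambda>f. cball 0 (norm f * K))"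
  proof (clarsimp simp: PiE_UNIV_domain Pi_iff ev_def)
    fix x f assume "x \<in> B"
    have "cmod (cdual_apply f x) \<le> norm f * norm x" by (rule norm_cdual_apply)
    also have "\<dots> \<le> norm f * K" using bounded[OF \<open>x \<in> B\<close>] by (intro mult_left_mono) auto
    finally show "cmod (cdual_apply f x) \<le> norm f * K" .
  qed
  moreover have "closed (PiE UNIV (\<lambda>f::'a cdual. cball (0::complex) (norm f * K)))"
  proof -
    have "PiE UNIV (\<lambda>f::'a cdual. cball (0::complex) (norm f * K)) = {F. \<forall>f. cmod (F f) \<le> norm f * K}"
      by (auto simp: PiE_UNIV_domain)
    moreover have "closed {F. \<forall>f::'a cdual. cmod (F f) \<le> norm f * K}"
      by (intro closed_Collect_all closed_Collect_le continuous_intros) simp_all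
    ultimately show ?thesis by simp
  qed
  ultimately have K': "compact (closure (ev ` B))"
    using closure_minimal[of "ev ` B"] compact_Int_closed[OF _ closed_closure]
    by (metis inf.absorb_iff2)
  \<comment> \<open>This is where \<open>repr\<close> enters: no limit point in the product leaves
    the image of the space, so the compact closure can be pulled back.\<close>
  have sub: "closure (ev ` B) \<subseteq> range ev"
  proof
    fix F assume F: "F \<in> closure (ev ` B)"
    have "\<exists>y\<in>B. \<forall>f\<in>A. cmod (cdual_apply f y - F f) < \<epsilon>" if "finite A" "0 < \<epsilon>" for A \<epsilon>
    proof -
      have "open {G. \<forall>f\<in>A. cmod (G f - F f) < \<epsilon>}"
      proof -
        have "open (\<Inter>f\<in>A. {G. cmod (G f - F f) < \<epsilon>})"
          using that(1) by (intro open_INT ballI open_Collect_less continuous_intros) simp_all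
        moreover have "(\<Inter>f\<in>A. {G. cmod (G f - F f) < \<epsilon>}) = {G. \<forall>f\<in>A. cmod (G f - F f) < \<epsilon>}"
          by auto
        ultimately show ?thesis by simp
      qed
      moreover have "F \<in> {G. \<forall>f\<in>A. cmod (G f - F f) < \<epsilon>}" using that by simp
      ultimately have "{G. \<forall>f\<in>A. cmod (G f - F f) < \<epsilon>} \<inter> ev ` B \<noteq> {}"
        using F open_Int_closure_eq_empty by blast
      then show ?thesis unfolding ev_def by blast
    qed
    then obtain z where "\<forall>f. F f = cdual_apply f z" using repr[of F] by blast
    then have "F = ev z" by (simp add: ev_def fun_eq_iff)
    then show "F \<in> range ev" by simp
  qed
  have "compactin weak_topology (ev -` closure (ev ` B))"
    unfolding compactin_def
  proof (intro conjI allI impI)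
    fix \<U> assume \<U>: "(\<forall>U\<in>\<U>. openin weak_topology U) \<and> ev -` closure (ev ` B) \<subseteq> \<Union>\<U>"
    then have "\<forall>U\<in>\<U>. \<exists>V. open V \<and> U = ev -` V"
      using openin_weak_topologyD by (auto simp: ev_alt)
    then obtain V where V: "\<And>U. U \<in> \<U> \<Longrightarrow> open (V U)" "\<And>U. U \<in> \<U> \<Longrightarrow> U = ev -` V U"
      by metis
    have cover: "closure (ev ` B) \<subseteq> (\<Union>U\<in>\<U>. V U)"
    proof
      fix F assume F: "F \<in> closure (ev ` B)"
      then obtain z where z: "F = ev z" using sub by blast
      then have "z \<in> \<Union>\<U>" using \<U> F by blast
      then show "F \<in> (\<Union>U\<in>\<U>. V U)" using V(2) z by blast
    qed
    obtain \<F> where "\<F> \<subseteq> \<U>" "finite \<F>" "closure (ev ` B) \<subseteq> (\<Union>U\<in>\<F>. V U)"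
      by (rule compactE_image[OF K', of \<U> V]) (use V(1) cover in auto)
    then show "\<exists>\<F>. finite \<F> \<and> \<F> \<subseteq> \<U> \<and> ev -` closure (ev ` B) \<subseteq> \<Union>\<F>"
      using V(2) by (intro exI[of _ \<F>]) blast
  qed simp
  moreover have "weak_topology closure_of B \<subseteq> ev -` closure (ev ` B)"
  proof
    fix x assume x: "x \<in> weak_topology closure_of B"
    have "continuous_map weak_topology euclidean ev"
      unfolding euclidean_product_topology[symmetric] continuous_map_componentwise_UNIV
      using openin_weak_vimage by (auto simp: continuous_map_def vimage_def ev_def)
    then have "ev x \<in> euclidean closure_of (ev ` B)"
      using x continuous_map_image_closure_subset by blast
    then show "x \<in> ev -` closure (ev ` B)" by simp
  qed
  ultimately show ?thesis
    unfolding relatively_weakly_compact_def by (rule closed_compactin) simp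
qed

section \<open>Ultraproduct coordinates\<close>

lemma cnj_sgn_mult: "cnj (sgn a) * a = complex_of_real (cmod a)"
proof (cases "a = 0")
  case False
  have "cnj a * a = complex_of_real ((cmod a)\<^sup>2)" by (metis complex_norm_square mult.commute)
  then show ?thesis using False by (simp add: sgn_eq power2_eq_square)
qed simp

text \<open>Either \<open>a \<le> s\<close>, or \<open>a / s\<close> exceeds 1 and is at most its
  p-th power. With small \<open>s\<close> this turns a bound on p-th powers into a bound on first
  powers, at the cost of \<open>s\<close> per term.\<close>

lemma le_add_powr:
  fixes a s p :: real
  assumes "0 \<le> a" "0 < s" "1 \<le> p"
  shows "a \<le> s + s powr (1 - p) * a powr p"
proof (cases "a \<le> s")
  case True
  moreover have "0 \<le> s powr (1 - p) * a powr p" by simp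
  ultimately show ?thesis by linarith
next
  case False
  have "1 \<le> (a / s) powr (p - 1)" using False assms by (intro ge_one_powr_ge_zero) auto
  also have "\<dots> = s powr (1 - p) * a powr (p - 1)"
    using False assms by (simp add: powr_divide powr_diff field_simps)
  finally have "a * 1 \<le> a * (s powr (1 - p) * a powr (p - 1))"
    using assms by (intro mult_left_mono)
  also have "\<dots> = s powr (1 - p) * a powr p"
    using False assms by (simp add: powr_diff field_simps)
  finally show ?thesis using assms by simp
qed

text \<open>The net of coordinate maps is a concrete stand-in for an embedding of \<open>'a\<close> into an
  ultraproduct of finite-dimensional \<open>\<ell>\<^sup>1\<close>-spaces.\<close>

locale ell1_coordinates =
  fixes U :: "'i filter" and D :: "'i \<Rightarrow> nat"
    and X :: "'i \<Rightarrow> 'a::complex_banach \<Rightarrow> nat \<Rightarrow> complex" and e :: "'i \<Rightarrow> nat \<Rightarrow> 'a" and C :: real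
  assumes nontrivial: "U \<noteq> bot"
    and ultra: "eventually P U \<or> eventually (\<lambda>i. \<not> P i) U"
    and sum_coord_le: "(\<Sum>t<D i. cmod (X i x t)) \<le> norm x"
    and expansion: "\<forall>\<^sub>F i in U. x = (\<Sum>t<D i. X i x t *\<^sub>C e i t)"
    and norm_basis: "t < D i \<Longrightarrow> norm (e i t) \<le> C"
    and coord_add: "\<forall>\<^sub>F i in U. \<forall>t. X i (x + y) t = X i x t + X i y t"
    and coord_scaleC: "\<forall>\<^sub>F i in U. \<forall>t. X i (c *\<^sub>C x) t = c * X i x t"
    and C_ge_1: "1 \<le> C"
begin

lemma coord_scaleR: "\<forall>\<^sub>F i in U. \<forall>t. X i (r *\<^sub>R x) t = complex_of_real r * X i x t"
  using coord_scaleC[of "complex_of_real r" x] by (simp add: scaleR_scaleC)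

lemma coord_diff: "\<forall>\<^sub>F i in U. \<forall>t. X i (x - y) t = X i x t - X i y t"
  using coord_add[of x "(-1) *\<^sub>R y"] coord_scaleR[of "-1" y] by eventually_elim simp

lemma norm_le_sum_coord: "\<forall>\<^sub>F i in U. norm x \<le> C * (\<Sum>t<D i. cmod (X i x t))"
  using expansion[of x]
proof eventually_elim
  case (elim i)
  have "norm x = norm (\<Sum>t<D i. X i x t *\<^sub>C e i t)" using elim by simp
  also have "\<dots> \<le> (\<Sum>t<D i. norm (X i x t *\<^sub>C e i t))" by (rule norm_sum)
  also have "\<dots> \<le> (\<Sum>t<D i. C * cmod (X i x t))"
    by (intro sum_mono) (simp add: norm_scaleC mult.commute[of C] mult_left_mono norm_basis)
  finally show ?case by (simp add: sum_distrib_left)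
qed

text \<open>The quantifier over \<open>f\<close> stands inside: the threshold depends on
  \<open>x\<close> alone, so one index serves functionals chosen later.\<close>

lemma apply_expansion: "\<forall>\<^sub>F i in U. \<forall>f. cdual_apply f x = (\<Sum>t<D i. X i x t * cdual_apply f (e i t))"
  using expansion[of x]
proof eventually_elim
  case (elim i)
  show ?case
  proof
    fix f
    have "cdual_apply f x = cdual_apply f (\<Sum>t<D i. X i x t *\<^sub>C e i t)" using elim by simp
    then show "cdual_apply f x = (\<Sum>t<D i. X i x t * cdual_apply f (e i t))"
      by (simp add: cdual_apply_sum cdual_apply_scaleC)
  qed
qed

section \<open>Functionals obtained as ultralimits\<close>

text \<open>The weights play the role of functions in the unit ball of L^infinity, with moduli
  adding up to at most 1 at each point. Pairing with the coordinates is bounded by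
  \<open>norm x\<close> at every index, hence converges along the ultrafilter; linearity of the
  limit needs only eventual linearity of the coordinates.\<close>

lemma limit_functionals:
  fixes w :: "'i \<Rightarrow> nat \<Rightarrow> nat \<Rightarrow> complex"
  assumes w: "\<And>i n t. t < D i \<Longrightarrow> (\<Sum>j<n. cmod (w i j t)) \<le> 1"
  obtains \<phi> :: "nat \<Rightarrow> 'a cdual" where "\<And>n x. (\<Sum>j<n. cmod (cdual_apply (\<phi> j) x)) \<le> norm x"
    and "\<And>j x. ((\<lambda>i. \<Sum>t<D i. w i j t * X i x t) \<longlongrightarrow> cdual_apply (\<phi> j) x) U"
proof -
  define S where "S i j x = (\<Sum>t<D i. w i j t * X i x t)" for i j x
  have sum_S: "(\<Sum>j<n. cmod (S i j x)) \<le> norm x" for i n x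
  proof -
    have "(\<Sum>j<n. cmod (S i j x)) \<le> (\<Sum>j<n. \<Sum>t<D i. cmod (w i j t) * cmod (X i x t))"
      unfolding S_def by (intro sum_mono order_trans[OF norm_sum]) (simp add: norm_mult)
    also have "\<dots> = (\<Sum>t<D i. (\<Sum>j<n. cmod (w i j t)) * cmod (X i x t))"
      by (subst sum.swap) (simp add: sum_distrib_right)
    also have "\<dots> \<le> (\<Sum>t<D i. 1 * cmod (X i x t))"
      using w by (intro sum_mono mult_right_mono) auto
    finally show ?thesis using sum_coord_le[of i x] by simp
  qed
  have S_le: "cmod (S i j x) \<le> norm x" for i j x
    using sum_S[where n = "Suc j" and i = i and x = x] sum_nonneg[of "{..<j}" "\<lambda>j. cmod (S i j x)"] by simp
  have "\<exists>l. ((\<lambda>i. S i j x) \<longlongrightarrow> l) U" for j x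
    by (rule ultrafilter_convergent[OF nontrivial ultra compact_cball[of 0 "norm x"], of "\<lambda>i. S i j x"])
      (simp_all add: S_le, blast)
  then obtain L where L: "\<And>j x. ((\<lambda>i. S i j x) \<longlongrightarrow> L j x) U" by metis
  have sum_L: "(\<Sum>j<n. cmod (L j x)) \<le> norm x" for n x
    by (rule tendsto_upperbound[OF tendsto_sum[OF tendsto_norm[OF L]] _ nontrivial])
      (simp add: sum_S)
  have "\<exists>f. \<forall>x. cdual_apply f x = L j x" for j
  proof -
    obtain f where "\<And>x. cdual_apply f x = L j x"
    proof (rule cdual_of_function[of "L j" 1])
      show "L j (x + y) = L j x + L j y" for x y
      proof (rule tendsto_unique[OF nontrivial L])
        have "\<forall>\<^sub>F i in U. S i j x + S i j y = S i j (x + y)"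
          using coord_add[of x y] by eventually_elim (simp add: S_def sum.distrib algebra_simps)
        then show "((\<lambda>i. S i j (x + y)) \<longlongrightarrow> L j x + L j y) U"
          by (rule Lim_transform_eventually[OF tendsto_add[OF L L]])
      qed
      show "L j (c *\<^sub>C x) = c * L j x" for c x
      proof (rule tendsto_unique[OF nontrivial L])
        have "\<forall>\<^sub>F i in U. c * S i j x = S i j (c *\<^sub>C x)"
          using coord_scaleC[of c x] by eventually_elim (simp add: S_def sum_distrib_left algebra_simps)
        then show "((\<lambda>i. S i j (c *\<^sub>C x)) \<longlongrightarrow> c * L j x) U"
          by (rule Lim_transform_eventually[OF tendsto_mult_left[OF L]])
      qed
      show "cmod (L j x) \<le> 1 * norm x" for x
        using sum_L[where n = "Suc j" and x = x] sum_nonneg[of "{..<j}" "\<lambda>j. cmod (L j x)"] by simp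
    qed blast
    then show ?thesis by blast
  qed
  then obtain \<phi> where \<phi>: "\<And>j x. cdual_apply (\<phi> j) x = L j x" by metis
  show thesis
    by (rule that[of \<phi>]) (use L sum_L in \<open>simp_all add: \<phi> S_def\<close>)
qed

text \<open>A substitute for the Hahn-Banach theorem, at the price of the factor \<open>C\<close>:
  the weights are the conjugate signs of the coordinates of \<open>x\<close>, placed in slot 0 of an
  otherwise zero family.\<close>

lemma norming_functional:
  fixes x :: 'a
  obtains f where "norm f \<le> 1" "norm x \<le> C * cmod (cdual_apply f x)"
proof -
  define w where "w i j t = (if j = (0::nat) then cnj (sgn (X i x t)) else 0)" for i j t
  have "(\<Sum>j<n. cmod (w i j t)) \<le> 1" for i n t
  proof -
    have "(\<Sum>j<n. cmod (w i j t)) \<le> (\<Sum>j<n. if j = 0 then 1 else 0)"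
      by (intro sum_mono) (simp add: w_def norm_sgn)
    also have "\<dots> \<le> 1" by (simp add: sum.delta)
    finally show ?thesis .
  qed
  then obtain \<phi> :: "nat \<Rightarrow> 'a cdual" where \<phi>: "\<And>n x. (\<Sum>j<n. cmod (cdual_apply (\<phi> j) x)) \<le> norm x"
    and lim: "\<And>j y. ((\<lambda>i. \<Sum>t<D i. w i j t * X i y t) \<longlongrightarrow> cdual_apply (\<phi> j) y) U"
    using limit_functionals[of w] by blast
  have "norm (\<phi> 0) \<le> 1"
    using \<phi>[where n = 1] by (intro norm_cdual_bound) simp_all
  moreover have "norm x \<le> C * cmod (cdual_apply (\<phi> 0) x)"
  proof (rule tendsto_lowerbound[OF tendsto_mult_left[OF tendsto_norm[OF lim]] _ nontrivial])
    show "\<forall>\<^sub>F i in U. norm x \<le> C * cmod (\<Sum>t<D i. w i 0 t * X i x t)"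
      using norm_le_sum_coord[of x]
    proof eventually_elim
      case (elim i)
      have "(\<Sum>t<D i. w i 0 t * X i x t) = complex_of_real (\<Sum>t<D i. cmod (X i x t))"
        by (simp add: w_def cnj_sgn_mult)
      then show ?case using elim by (simp add: sum_nonneg del: of_real_sum)
    qed
  qed
  ultimately show thesis by (rule that)
qed

section \<open>Uniform integrability in coordinates\<close>

text \<open>This is the integral of the positive part of |y| - g. The majorant \<open>g\<close> is
  encoded by finitely many vectors, as the sum of their moduli, because a vector has coordinates at
  every index whereas a function on one index set means nothing on another.\<close>

definition excess :: "'i \<Rightarrow> 'a \<Rightarrow> nat \<Rightarrow> (nat \<Rightarrow> 'a) \<Rightarrow> real"
  where "excess i y k x = (\<Sum>t<D i. max 0 (cmod (X i y t) - (\<Sum>m<k. cmod (X i (x m) t))))"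

text \<open>In \<open>L\<^sup>1(\<mu>)\<close> this is uniform integrability of \<open>B\<close>.\<close>

definition almost_order_bounded :: "'a set \<Rightarrow> bool"
  where "almost_order_bounded B \<longleftrightarrow> (\<forall>\<delta>>0. \<exists>k x. \<forall>y\<in>B. \<forall>\<^sub>F i in U. excess i y k x \<le> \<delta>)"

lemma sum_majorant_le: "(\<Sum>t<D i. \<Sum>m<k. cmod (X i (x m) t)) \<le> (\<Sum>m<k. norm (x m))"
  by (subst sum.swap) (intro sum_mono sum_coord_le)

lemma almost_order_boundedD:
  assumes "almost_order_bounded B"
  obtains K where "0 < K" "\<And>y. y \<in> B \<Longrightarrow> norm y \<le> K"
proof -
  obtain k x where kx: "\<And>y. y \<in> B \<Longrightarrow> \<forall>\<^sub>F i in U. excess i y k x \<le> 1"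
    using assms unfolding almost_order_bounded_def by (meson zero_less_one)
  have "norm y \<le> C * (1 + (\<Sum>m<k. norm (x m)))" if "y \<in> B" for y
  proof -
    have "\<forall>\<^sub>F i in U. norm y \<le> C * (1 + (\<Sum>m<k. norm (x m)))"
      using kx[OF that] norm_le_sum_coord[of y]
    proof eventually_elim
      case (elim i)
      have "(\<Sum>t<D i. cmod (X i y t)) \<le> (\<Sum>t<D i. max 0 (cmod (X i y t) - (\<Sum>m<k. cmod (X i (x m) t)))
          + (\<Sum>m<k. cmod (X i (x m) t)))"
        by (intro sum_mono) simp
      also have "\<dots> \<le> 1 + (\<Sum>m<k. norm (x m))"
        using elim(1) sum_majorant_le[where k = k and i = i and x = x] by (simp add: sum.distrib excess_def)
      finally have "C * (\<Sum>t<D i. cmod (X i y t)) \<le> C * (1 + (\<Sum>m<k. norm (x m)))"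
        using C_ge_1 by (intro mult_left_mono) auto
      then show ?case using elim(2) by simp
    qed
    then show ?thesis using nontrivial by simp
  qed
  moreover have "0 < C * (1 + (\<Sum>m<k. norm (x m)))"
    using C_ge_1 sum_nonneg[of "{..<k}" "\<lambda>m. norm (x m)"] by (simp add: add_pos_nonneg)
  ultimately show thesis using that by blast
qed

text \<open>If \<open>B\<close> is not almost order bounded, there are infinitely many \<open>y\<^sub>j \<in> B\<close>, each with a
  definite part of its mass where it dominates a huge multiple of its predecessors; removing
  the later such sets makes them disjoint.\<close>

lemma wuC_of_not_almost_order_bounded:
  assumes "\<not> almost_order_bounded B" and "0 < K" and K: "\<And>y. y \<in> B \<Longrightarrow> norm y \<le> K"
  obtains c and y :: "nat \<Rightarrow> 'a" and \<phi> :: "nat \<Rightarrow> 'a cdual" where "0 < c" "\<And>j. y j \<in> B"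
    "\<And>n x. (\<Sum>j<n. cmod (cdual_apply (\<phi> j) x)) \<le> norm x" "\<And>j. c \<le> cmod (cdual_apply (\<phi> j) (y j))"
proof -
  obtain \<delta> where "0 < \<delta>" and \<delta>: "\<And>k x. \<exists>y\<in>B. \<not> (\<forall>\<^sub>F i in U. excess i y k x \<le> \<delta>)"
    using assms(1) unfolding almost_order_bounded_def by blast
  \<comment> \<open>With this factor an earlier \<open>y m\<close> has mass at most
    \<open>K / R k = \<delta> * (1/2) ^ (k + 2)\<close> on the set where \<open>y k\<close>
    dominates.\<close>
  define R where "R k = K * 2 ^ (k + 2) / \<delta>" for k :: nat
  have R_pos: "0 < R k" for k using \<open>0 < K\<close> \<open>0 < \<delta>\<close> by (simp add: R_def)
  define P where "P y k r \<longleftrightarrow> r \<in> B \<and> (\<forall>\<^sub>F i in U. \<delta> < excess i r k (\<lambda>m. R k *\<^sub>R y m))"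
    for y :: "nat \<Rightarrow> 'a" and k r
  have "\<exists>y. \<forall>k. P y k (y k)"
  proof (rule dependent_wellorder_choice)
    show "P y k r = P y' k r" if "\<And>m. m < k \<Longrightarrow> y m = y' m" for y y' k r
      using that by (simp add: P_def excess_def)
  next
    fix k and y :: "nat \<Rightarrow> 'a"
    obtain r where "r \<in> B" "\<not> (\<forall>\<^sub>F i in U. excess i r k (\<lambda>m. R k *\<^sub>R y m) \<le> \<delta>)"
      using \<delta> by blast
    then show "\<exists>r. P y k r"
      using ultra[of "\<lambda>i. excess i r k (\<lambda>m. R k *\<^sub>R y m) \<le> \<delta>"] by (auto simp: P_def not_le)
  qed
  then obtain y where y: "\<And>k. y k \<in> B" "\<And>k. \<forall>\<^sub>F i in U. \<delta> < excess i (y k) k (\<lambda>m. R k *\<^sub>R y m)"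
    unfolding P_def by blast
  \<comment> \<open>Only on this set is the integrand of the excess of \<open>y k\<close> positive,
    so \<open>y k\<close> has mass greater than \<delta> there.\<close>
  define F where "F i k = {t. t < D i \<and> R k * (\<Sum>m<k. cmod (X i (y m) t)) < cmod (X i (y k) t)}" for i k
  have F_fin [simp]: "finite (F i k)" for i k by (simp add: F_def)
  have F_sub: "F i k \<subseteq> {..<D i}" for i k by (auto simp: F_def)
  have F_big: "\<forall>\<^sub>F i in U. \<delta> < (\<Sum>t\<in>F i k. cmod (X i (y k) t))" for k
  proof -
    have "\<forall>\<^sub>F i in U. \<forall>m\<in>{..<k}. \<forall>t. X i (R k *\<^sub>R y m) t = complex_of_real (R k) * X i (y m) t"
      by (intro eventually_ball_finite ballI coord_scaleR) simp
    then show ?thesis using y(2)[of k]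
    proof eventually_elim
      case (elim i)
      have "\<delta> < excess i (y k) k (\<lambda>m. R k *\<^sub>R y m)" by (rule elim)
      also have "\<dots> = (\<Sum>t<D i. max 0 (cmod (X i (y k) t) - R k * (\<Sum>m<k. cmod (X i (y m) t))))"
        using elim(1) R_pos[of k] by (simp add: excess_def norm_mult sum_distrib_left)
      also have "\<dots> \<le> (\<Sum>t<D i. if t \<in> F i k then cmod (X i (y k) t) else 0)"
        using R_pos[of k] by (intro sum_mono) (auto simp: F_def max_def sum_nonneg)
      also have "\<dots> = (\<Sum>t\<in>F i k. cmod (X i (y k) t))"
        using F_sub[of i k] by (simp add: sum.If_cases Int_absorb1)
      finally show ?case .
    qed
  qed
  have F_small: "(\<Sum>t\<in>F i k. cmod (X i (y m) t)) \<le> \<delta> * (1/2) ^ (k + 2)" if "m < k" for i k m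
  proof -
    have "R k * (\<Sum>t\<in>F i k. cmod (X i (y m) t)) = (\<Sum>t\<in>F i k. R k * cmod (X i (y m) t))"
      by (rule sum_distrib_left)
    also have "\<dots> \<le> (\<Sum>t\<in>F i k. cmod (X i (y k) t))"
    proof (rule sum_mono)
      fix t assume "t \<in> F i k"
      have "R k * cmod (X i (y m) t) \<le> R k * (\<Sum>m<k. cmod (X i (y m) t))"
        using R_pos[of k] that by (intro mult_left_mono member_le_sum) auto
      also have "\<dots> \<le> cmod (X i (y k) t)" using \<open>t \<in> F i k\<close> by (simp add: F_def)
      finally show "R k * cmod (X i (y m) t) \<le> cmod (X i (y k) t)" .
    qed
    also have "\<dots> \<le> (\<Sum>t<D i. cmod (X i (y k) t))"
      using F_sub by (intro sum_mono2) auto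
    also have "\<dots> \<le> K" using sum_coord_le[of i "y k"] K[OF y(1)[of k]] by simp
    finally have "(\<Sum>t\<in>F i k. cmod (X i (y m) t)) \<le> K / R k"
      using R_pos[of k] by (simp add: pos_le_divide_eq mult.commute)
    also have "K / R k = \<delta> * (1/2) ^ (k + 2)"
      using \<open>0 < K\<close> by (simp add: R_def power_divide)
    finally show ?thesis .
  qed
  \<comment> \<open>Removing all later sets makes these disjoint. It costs \<open>y j\<close> at
    most the sum of \<open>\<delta> * (1/2) ^ (k + 2)\<close> over later \<open>k\<close>, hence at
    most half of \<delta>.\<close>
  define G where "G i j = F i j - (\<Union>k\<in>{j<..}. F i k)" for i j
  have G_fin [simp]: "finite (G i j)" for i j by (simp add: G_def)
  have G_sub: "G i j \<subseteq> {..<D i}" for i j unfolding G_def using F_sub[of i j] by blast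
  have G_big: "\<forall>\<^sub>F i in U. \<delta> / 2 \<le> (\<Sum>t\<in>G i j. cmod (X i (y j) t))" for j
    using F_big[of j]
  proof eventually_elim
    case (elim i)
    \<comment> \<open>Infinitely many later sets are removed, but only finitely many points are
      lost. Choosing one responsible index per point keeps the double sum finite.\<close>
    define \<kappa> where "\<kappa> t = (SOME k. j < k \<and> t \<in> F i k)" for t
    have \<kappa>: "j < \<kappa> t \<and> t \<in> F i (\<kappa> t)" if "t \<in> F i j - G i j" for t
    proof -
      have "\<exists>k. j < k \<and> t \<in> F i k" using that by (auto simp: G_def)
      from someI_ex[OF this] show ?thesis by (simp add: \<kappa>_def)
    qed
    have "(\<Sum>t\<in>F i j - G i j. cmod (X i (y j) t)) \<le>
      (\<Sum>t\<in>F i j - G i j. \<Sum>k\<in>\<kappa> ` (F i j - G i j). if t \<in> F i k then cmod (X i (y j) t) else 0)"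
    proof (rule sum_mono)
      fix t assume t: "t \<in> F i j - G i j"
      have "(if t \<in> F i (\<kappa> t) then cmod (X i (y j) t) else 0) \<le>
        (\<Sum>k\<in>\<kappa> ` (F i j - G i j). if t \<in> F i k then cmod (X i (y j) t) else 0)"
        using t by (intro member_le_sum[where f = "\<lambda>k. if t \<in> F i k then cmod (X i (y j) t) else 0"]) auto
      then show "cmod (X i (y j) t) \<le>
        (\<Sum>k\<in>\<kappa> ` (F i j - G i j). if t \<in> F i k then cmod (X i (y j) t) else 0)"
        using \<kappa>[OF t] by simp
    qed
    also have "\<dots> = (\<Sum>k\<in>\<kappa> ` (F i j - G i j). \<Sum>t\<in>F i j - G i j. if t \<in> F i k then cmod (X i (y j) t) else 0)"
      by (rule sum.swap)
    also have "\<dots> \<le> (\<Sum>k\<in>\<kappa> ` (F i j - G i j). \<delta> * (1/2) ^ (k + 2))"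
    proof (rule sum_mono)
      fix k assume "k \<in> \<kappa> ` (F i j - G i j)"
      then have "j < k" using \<kappa> by auto
      have "(\<Sum>t\<in>F i j - G i j. if t \<in> F i k then cmod (X i (y j) t) else 0)
        = (\<Sum>t\<in>(F i j - G i j) \<inter> F i k. cmod (X i (y j) t))"
        by (simp add: sum.inter_restrict)
      also have "\<dots> \<le> (\<Sum>t\<in>F i k. cmod (X i (y j) t))"
        by (intro sum_mono2) auto
      also have "\<dots> \<le> \<delta> * (1/2) ^ (k + 2)" by (rule F_small[OF \<open>j < k\<close>])
      finally show "(\<Sum>t\<in>F i j - G i j. if t \<in> F i k then cmod (X i (y j) t) else 0) \<le> \<delta> * (1/2) ^ (k + 2)" .
    qed
    also have "\<dots> = \<delta> / 4 * (\<Sum>k\<in>\<kappa> ` (F i j - G i j). (1/2) ^ k)"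
      by (simp add: sum_distrib_left power2_eq_square)
    also have "\<dots> \<le> \<delta> / 4 * (\<Sum>k. (1/2) ^ k)"
      using \<open>0 < \<delta>\<close> by (intro mult_left_mono sum_le_suminf summable_geometric) auto
    also have "\<dots> = \<delta> / 2" by (simp add: suminf_geometric)
    finally have "(\<Sum>t\<in>F i j - G i j. cmod (X i (y j) t)) \<le> \<delta> / 2" .
    moreover have "(\<Sum>t\<in>F i j. cmod (X i (y j) t)) =
      (\<Sum>t\<in>F i j - G i j. cmod (X i (y j) t)) + (\<Sum>t\<in>G i j. cmod (X i (y j) t))"
      by (rule sum.subset_diff) (auto simp: G_def)
    ultimately show ?case using elim by simp
  qed
  have G_disjoint: "j = j'" if "t \<in> G i j" "t \<in> G i j'" for t i j j'
    using that by (cases j j' rule: linorder_cases) (auto simp: G_def)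
  define w where "w i j t = (if t \<in> G i j then cnj (sgn (X i (y j) t)) else 0)" for i j t
  have w: "(\<Sum>j<n. cmod (w i j t)) \<le> 1" for i n t
  proof (cases "\<exists>j0. t \<in> G i j0")
    case True
    then obtain j0 where "t \<in> G i j0" by blast
    then have "(\<Sum>j<n. cmod (w i j t)) \<le> (\<Sum>j<n. if j = j0 then 1 else 0)"
      by (intro sum_mono) (use G_disjoint in \<open>auto simp: w_def norm_sgn\<close>)
    also have "\<dots> \<le> 1" by (simp add: sum.delta)
    finally show ?thesis .
  qed (simp add: w_def)
  obtain \<phi> :: "nat \<Rightarrow> 'a cdual" where \<phi>: "\<And>n x. (\<Sum>j<n. cmod (cdual_apply (\<phi> j) x)) \<le> norm x"
    and lim: "\<And>j x. ((\<lambda>i. \<Sum>t<D i. w i j t * X i x t) \<longlongrightarrow> cdual_apply (\<phi> j) x) U"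
    using limit_functionals[of w] w by blast
  have "\<delta> / 2 \<le> cmod (cdual_apply (\<phi> j) (y j))" for j
  proof (rule tendsto_lowerbound[OF tendsto_norm[OF lim] _ nontrivial])
    show "\<forall>\<^sub>F i in U. \<delta> / 2 \<le> cmod (\<Sum>t<D i. w i j t * X i (y j) t)"
      using G_big[of j]
    proof eventually_elim
      case (elim i)
      have "(\<Sum>t<D i. w i j t * X i (y j) t)
        = (\<Sum>t<D i. if t \<in> G i j then complex_of_real (cmod (X i (y j) t)) else 0)"
        by (intro sum.cong) (auto simp: w_def cnj_sgn_mult)
      also have "\<dots> = complex_of_real (\<Sum>t\<in>G i j. cmod (X i (y j) t))"
        using G_sub[of i j] by (simp add: sum.If_cases Int_absorb1)
      finally show ?case using elim by (simp add: sum_nonneg del: of_real_sum)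
    qed
  qed
  with \<open>0 < \<delta>\<close> y(1) \<phi> show thesis by (intro that[of "\<delta> / 2" y \<phi>]) auto
qed

end

section \<open>Tuples of functionals with weak summing norm at most 1\<close>

text \<open>The weak summing norm in the dual is tested on the bidual; here the test element is
  evaluation at \<open>x\<close>, scaled by \<open>1 / c\<close>.\<close>

lemma weak_summing_norm_apply:
  fixes f :: "nat \<Rightarrow> 'a::complex_normed_vector cdual"
  assumes p: "1 \<le> p" and f: "weak_summing_norm p n f \<le> 1" and x: "norm x \<le> c" and "0 < c"
  shows "(\<Sum>j<n. cmod (cdual_apply (f j) x) powr p) \<le> c powr p"
proof -
  have "norm (eval_cdual ((1 / c) *\<^sub>R x)) \<le> 1"
    by (rule order_trans[OF norm_eval_cdual_le]) (use x \<open>0 < c\<close> in simp)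
  then have "(\<Sum>j<n. cmod (cdual_apply (eval_cdual ((1 / c) *\<^sub>R x)) (f j)) powr p) \<le> 1"
    using f unfolding weak_summing_norm_le_1_iff[OF p] by blast
  moreover have "cmod (cdual_apply (eval_cdual ((1 / c) *\<^sub>R x)) (f j)) powr p
    = cmod (cdual_apply (f j) x) powr p / c powr p" for j
    using \<open>0 < c\<close> by (simp add: cdual_apply_scaleR powr_divide)
  ultimately show ?thesis using \<open>0 < c\<close> by (simp add: sum_divide_distrib[symmetric] divide_le_eq)
qed

lemma weak_summing_norm_apply_le:
  fixes f :: "nat \<Rightarrow> 'a::complex_normed_vector cdual"
  assumes p: "1 \<le> p" and "weak_summing_norm p n f \<le> 1" and "norm x \<le> c" "0 < c" and "j < n"
  shows "cmod (cdual_apply (f j) x) \<le> c"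
proof (rule ccontr)
  assume "\<not> ?thesis"
  then have "c powr p < cmod (cdual_apply (f j) x) powr p"
    using p \<open>0 < c\<close> by (intro powr_less_mono2) auto
  also have "\<dots> \<le> (\<Sum>j<n. cmod (cdual_apply (f j) x) powr p)"
    using \<open>j < n\<close> by (intro member_le_sum[where f = "\<lambda>j. cmod (cdual_apply (f j) x) powr p"]) auto
  also have "\<dots> \<le> c powr p" by (rule weak_summing_norm_apply[OF assms(1-4)])
  finally show False by simp
qed

text \<open>The hypothesis tests only points of the space, the conclusion all of the bidual. The
  passage is by signs: the sum of the moduli of \<psi>(\<phi>_j) is the value of \<psi> at one
  combination \<open>g\<close> of the functionals, and \<open>norm g \<le> 1\<close> is checked on
  points. Numbers in [0,1] dominate their p-th powers.\<close>

lemma weak_summing_norm_wuC: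
  fixes \<phi> :: "nat \<Rightarrow> 'a::complex_normed_vector cdual"
  assumes p: "1 \<le> p" and \<phi>: "\<And>x. (\<Sum>j<n. cmod (cdual_apply (\<phi> j) x)) \<le> norm x"
  shows "weak_summing_norm p n \<phi> \<le> 1"
  unfolding weak_summing_norm_le_1_iff[OF p]
proof (intro allI impI)
  fix \<psi> :: "'a cdual cdual" assume \<psi>: "norm \<psi> \<le> 1"
  define a where "a j = cnj (sgn (cdual_apply \<psi> (\<phi> j)))" for j
  define g where "g = (\<Sum>j<n. a j *\<^sub>C \<phi> j)"
  have "norm g \<le> 1"
  proof (rule norm_cdual_bound)
    fix x
    have "cmod (cdual_apply g x) \<le> (\<Sum>j<n. cmod (a j) * cmod (cdual_apply (\<phi> j) x))"
      unfolding g_def cdual_apply_sum_left cdual_apply_scaleC_left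
      by (rule order_trans[OF norm_sum]) (simp add: norm_mult)
    also have "\<dots> \<le> (\<Sum>j<n. 1 * cmod (cdual_apply (\<phi> j) x))"
      by (intro sum_mono mult_right_mono) (auto simp: a_def norm_sgn)
    finally show "cmod (cdual_apply g x) \<le> 1 * norm x" using \<phi>[of x] by simp
  qed simp
  have "cdual_apply \<psi> g = complex_of_real (\<Sum>j<n. cmod (cdual_apply \<psi> (\<phi> j)))"
    by (simp add: g_def cdual_apply_sum cdual_apply_scaleC a_def cnj_sgn_mult)
  then have "(\<Sum>j<n. cmod (cdual_apply \<psi> (\<phi> j))) = cmod (cdual_apply \<psi> g)"
    by (simp add: sum_nonneg del: of_real_sum)
  also have "\<dots> \<le> norm \<psi> * norm g" by (rule norm_cdual_apply)
  also have "\<dots> \<le> 1" using \<psi> \<open>norm g \<le> 1\<close> by (simp add: mult_le_one)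
  finally have sum: "(\<Sum>j<n. cmod (cdual_apply \<psi> (\<phi> j))) \<le> 1" .
  have "(\<Sum>j<n. cmod (cdual_apply \<psi> (\<phi> j)) powr p) \<le> (\<Sum>j<n. cmod (cdual_apply \<psi> (\<phi> j)))"
  proof (rule sum_mono)
    fix j assume "j \<in> {..<n}"
    then have "cmod (cdual_apply \<psi> (\<phi> j)) \<le> (\<Sum>j<n. cmod (cdual_apply \<psi> (\<phi> j)))"
      by (intro member_le_sum[where f = "\<lambda>j. cmod (cdual_apply \<psi> (\<phi> j))"]) auto
    with sum have "cmod (cdual_apply \<psi> (\<phi> j)) \<le> 1" by simp
    then show "cmod (cdual_apply \<psi> (\<phi> j)) powr p \<le> cmod (cdual_apply \<psi> (\<phi> j))"
      using powr_mono'[of 1 p "cmod (cdual_apply \<psi> (\<phi> j))"] p by simp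
  qed
  with sum show "(\<Sum>j<n. cmod (cdual_apply \<psi> (\<phi> j)) powr p) \<le> 1" by simp
qed

context ell1_coordinates begin

section \<open>Almost order bounded sets are relatively weakly compact\<close>

text \<open>Modulo \<open>\<delta>\<close>, the elements of \<open>B\<close> are of the form \<open>g h\<close> with \<open>h\<close> bounded in \<open>L\<^sup>2(g)\<close>, so a
  weak\<open>*\<close> cluster point is approximated in norm by the usual minimal norm argument in Hilbert space.\<close>

lemma weak_star_limit_approx:
  fixes F :: "'a cdual \<Rightarrow> complex"
  assumes "almost_order_bounded B" and "0 < \<delta>"
    and F: "\<And>A \<epsilon>. finite A \<Longrightarrow> 0 < \<epsilon> \<Longrightarrow> \<exists>y\<in>B. \<forall>f\<in>A. cmod (cdual_apply f y - F f) < \<epsilon>"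
  shows "\<exists>z. \<forall>f. cmod (F f - cdual_apply f z) \<le> \<delta> * norm f"
proof -
  \<comment> \<open>The final distance estimate collects four errors of size \<open>d\<close>, and
    passing from coordinates to the norm costs the factor \<open>C\<close>.\<close>
  define d where "d = \<delta> / (4 * C)"
  have "0 < d" using \<open>0 < \<delta>\<close> C_ge_1 by (simp add: d_def)
  then obtain k x where kx: "\<And>y. y \<in> B \<Longrightarrow> \<forall>\<^sub>F i in U. excess i y k x \<le> d"
    using assms(1) unfolding almost_order_bounded_def by meson
  define g where "g i t = (\<Sum>m<k. cmod (X i (x m) t))" for i t
  have g_nonneg: "0 \<le> g i t" for i t by (simp add: g_def sum_nonneg)
  define \<Gamma> where "\<Gamma> = (\<Sum>m<k. norm (x m))"
  have \<Gamma>_nonneg: "0 \<le> \<Gamma>" by (simp add: \<Gamma>_def sum_nonneg)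
  have sum_g: "(\<Sum>t<D i. g i t) \<le> \<Gamma>" for i
    unfolding g_def \<Gamma>_def by (rule sum_majorant_le)
  \<comment> \<open>A vector \<open>z\<close> that approximates \<open>F\<close> on \<open>A\<close>
    and whose coordinates are \<open>g * h\<close> up to an l^1 error \<open>d\<close>, with energy
    at most \<open>v\<close> in L^2(g).\<close>
  define P where "P A \<epsilon> z h v \<longleftrightarrow> (\<forall>f\<in>A. cmod (cdual_apply f z - F f) < \<epsilon>) \<and>
    (\<forall>\<^sub>F i in U. (\<Sum>t<D i. cmod (X i z t - complex_of_real (g i t) * h i t)) \<le> d) \<and>
    (\<forall>\<^sub>F i in U. (\<Sum>t<D i. g i t * (cmod (h i t))\<^sup>2) \<le> v)"
    for A \<epsilon> z h v
  \<comment> \<open>The energy levels sufficient for every finite set of test functionals and every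
    precision; the infimum of \<open>V\<close> replaces the minimal squared norm.\<close>
  define V where "V = {v. \<forall>A \<epsilon>. finite A \<longrightarrow> 0 < \<epsilon> \<longrightarrow> (\<exists>z h. P A \<epsilon> z h v)}"
  have "\<Gamma> \<in> V"
    unfolding V_def
  proof (intro CollectI allI impI)
    fix A :: "'a cdual set" and \<epsilon> :: real assume "finite A" "0 < \<epsilon>"
    then obtain y where y: "y \<in> B" "\<forall>f\<in>A. cmod (cdual_apply f y - F f) < \<epsilon>"
      using F by blast
    \<comment> \<open>Truncating \<open>y\<close> at modulus \<open>g\<close> leaves exactly the
      excess as error. Where \<open>g\<close> vanishes in the first case the coordinate vanishes
      too, and division by 0 gives the harmless value 0.\<close>
    define h where "h i t = (if cmod (X i y t) \<le> g i t then X i y t / complex_of_real (g i t) else sgn (X i y t))" for i t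
    have h: "cmod (h i t) \<le> 1" for i t
      using g_nonneg[of i t] by (auto simp: h_def norm_divide norm_sgn divide_le_eq_1)
    have "cmod (X i y t - complex_of_real (g i t) * h i t) \<le> max 0 (cmod (X i y t) - g i t)" for i t
    proof (cases "cmod (X i y t) \<le> g i t")
      case True
      then show ?thesis by (cases "g i t = 0") (auto simp: h_def)
    next
      case False
      then have "X i y t \<noteq> 0" using g_nonneg[of i t] by auto
      then have "X i y t - complex_of_real (g i t) * h i t = complex_of_real (cmod (X i y t) - g i t) * sgn (X i y t)"
        using False by (simp add: h_def sgn_eq field_simps)
      then show ?thesis using False \<open>X i y t \<noteq> 0\<close>
        by (simp add: norm_mult norm_sgn del: of_real_diff)
    qed
    then have "(\<Sum>t<D i. cmod (X i y t - complex_of_real (g i t) * h i t)) \<le> excess i y k x" for i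
      unfolding excess_def g_def by (intro sum_mono)
    then have "\<forall>\<^sub>F i in U. (\<Sum>t<D i. cmod (X i y t - complex_of_real (g i t) * h i t)) \<le> d"
      using kx[OF y(1)] by (auto elim!: eventually_mono intro: order_trans)
    moreover have "(\<Sum>t<D i. g i t * (cmod (h i t))\<^sup>2) \<le> \<Gamma>" for i
    proof -
      have "(\<Sum>t<D i. g i t * (cmod (h i t))\<^sup>2) \<le> (\<Sum>t<D i. g i t * 1)"
        using h g_nonneg by (intro sum_mono mult_left_mono) (simp_all add: power_le_one)
      then show ?thesis using sum_g[of i] by simp
    qed
    ultimately have "P A \<epsilon> y h \<Gamma>" using y(2) by (simp add: P_def)
    then show "\<exists>z h. P A \<epsilon> z h \<Gamma>" by blast
  qed
  have V_solvable: "\<exists>z h. P A \<epsilon> z h v" if "v \<in> V" "finite A" "0 < \<epsilon>" for v A \<epsilon>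
    using that by (simp add: V_def)
  have V_nonneg: "0 \<le> v" if "v \<in> V" for v
  proof -
    obtain z h where "P {} 1 z h v" using V_solvable[OF \<open>v \<in> V\<close>, of "{}" 1] by auto
    then have "\<forall>\<^sub>F i in U. (\<Sum>t<D i. g i t * (cmod (h i t))\<^sup>2) \<le> v" by (simp add: P_def)
    then have "\<forall>\<^sub>F i in U. 0 \<le> v"
      by eventually_elim (rule order_trans[rotated], assumption, simp add: sum_nonneg g_nonneg)
    then show ?thesis using nontrivial by simp
  qed
  then have "bdd_below V" by (auto simp: bdd_below_def)
  \<comment> \<open>The energy of the difference of two near-minimal solutions will be at most
    \<open>8 * \<eta>\<close>. Then \<open>s * \<Gamma> + 8 * \<eta> / s\<close> bounds the l^1
    distance, and these choices make each summand at most \<open>d\<close>.\<close>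
  define s where "s = d / (\<Gamma> + 1)"
  have "0 < s" using \<open>0 < d\<close> \<Gamma>_nonneg by (simp add: s_def)
  define \<eta> where "\<eta> = s * d / 8"
  have "0 < \<eta>" using \<open>0 < d\<close> \<open>0 < s\<close> by (simp add: \<eta>_def)
  obtain v where v: "v \<in> V" "v < Inf V + \<eta>"
    using \<open>\<Gamma> \<in> V\<close> \<open>0 < \<eta>\<close> cInf_lessD[of V "Inf V + \<eta>"] by auto
  \<comment> \<open>A level below the infimum fails for one specific \<open>A0\<close> and
    \<open>\<epsilon>0\<close>. Fixing \<open>z\<close> for this pair makes it independent of the
    functional \<open>f\<close> treated afterwards.\<close>
  have "Inf V - \<eta> \<notin> V"
    using cInf_lower[OF _ \<open>bdd_below V\<close>] \<open>0 < \<eta>\<close> by fastforce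
  then obtain A0 \<epsilon>0 where A0: "finite A0" "0 < \<epsilon>0" "\<And>z h. \<not> P A0 \<epsilon>0 z h (Inf V - \<eta>)"
    unfolding V_def by blast
  obtain z h where z: "P A0 \<epsilon>0 z h v" using V_solvable[OF v(1) A0(1,2)] by blast
  have "cmod (F f - cdual_apply f z) \<le> \<delta> * norm f" for f
  proof (rule field_le_epsilon)
    fix \<epsilon> :: real assume "0 < \<epsilon>"
    obtain z' h' where z': "P (insert f A0) (min \<epsilon>0 \<epsilon>) z' h' v"
      using V_solvable[OF v(1), of "insert f A0" "min \<epsilon>0 \<epsilon>"] A0(1,2) \<open>0 < \<epsilon>\<close> by auto
    \<comment> \<open>The midpoint again solves the problem for \<open>A0\<close> and
      \<open>\<epsilon>0\<close>, so its energy exceeds \<open>Inf V - \<eta>\<close>. By the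
      parallelogram law the two solutions are then close.\<close>
    define zm where "zm = (1/2) *\<^sub>R (z + z')"
    define hm where "hm i t = (h i t + h' i t) / 2" for i t
    have norm_mid_le: "cmod ((a + b) / 2) \<le> (cmod a + cmod b) / 2" for a b
      by (simp add: norm_divide norm_triangle_ineq)
    have norm_mid_less: "cmod ((a + b) / 2) < r" if "cmod a < r" "cmod b < r" for a b r
      by (rule le_less_trans[OF norm_mid_le]) (use that in simp)
    have mid1: "\<forall>f\<in>A0. cmod (cdual_apply f zm - F f) < \<epsilon>0"
    proof
      fix f' assume "f' \<in> A0"
      then have "cmod (((cdual_apply f' z - F f') + (cdual_apply f' z' - F f')) / 2) < \<epsilon>0"
        using z z' by (intro norm_mid_less) (auto simp: P_def)
      moreover have "cdual_apply f' zm - F f' = ((cdual_apply f' z - F f') + (cdual_apply f' z' - F f')) / 2"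
        by (simp add: zm_def cdual_apply_scaleR cdual_apply_add scaleR_conv_of_real add_divide_distrib diff_divide_distrib)
      ultimately show "cmod (cdual_apply f' zm - F f') < \<epsilon>0" by (simp only:)
    qed
    have ev: "\<forall>\<^sub>F i in U. (\<Sum>t<D i. cmod (X i z t - complex_of_real (g i t) * h i t)) \<le> d"
      "\<forall>\<^sub>F i in U. (\<Sum>t<D i. cmod (X i z' t - complex_of_real (g i t) * h' i t)) \<le> d"
      "\<forall>\<^sub>F i in U. (\<Sum>t<D i. g i t * (cmod (h i t))\<^sup>2) \<le> v"
      "\<forall>\<^sub>F i in U. (\<Sum>t<D i. g i t * (cmod (h' i t))\<^sup>2) \<le> v"
      using z z' by (auto simp: P_def)
    have mid2: "\<forall>\<^sub>F i in U. (\<Sum>t<D i. cmod (X i zm t - complex_of_real (g i t) * hm i t)) \<le> d"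
      using ev(1,2) coord_add[of z z'] coord_scaleR[of "1/2" "z + z'"]
    proof eventually_elim
      case (elim i)
      have "X i zm t - complex_of_real (g i t) * hm i t =
        ((X i z t - complex_of_real (g i t) * h i t) + (X i z' t - complex_of_real (g i t) * h' i t)) / 2" for t
        using elim(3,4) by (simp add: zm_def hm_def field_simps)
      then have "(\<Sum>t<D i. cmod (X i zm t - complex_of_real (g i t) * hm i t)) \<le>
        (\<Sum>t<D i. (cmod (X i z t - complex_of_real (g i t) * h i t) + cmod (X i z' t - complex_of_real (g i t) * h' i t)) / 2)"
        by (intro sum_mono) (simp only: norm_mid_le)
      also have "\<dots> \<le> d" using elim(1,2) by (simp add: sum.distrib sum_divide_distrib[symmetric])
      finally show ?case .
    qed
    have "\<not> (\<forall>\<^sub>F i in U. (\<Sum>t<D i. g i t * (cmod (hm i t))\<^sup>2) \<le> Inf V - \<eta>)"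
      using A0(3)[of zm hm] mid1 mid2 by (auto simp: P_def)
    then have "\<forall>\<^sub>F i in U. Inf V - \<eta> < (\<Sum>t<D i. g i t * (cmod (hm i t))\<^sup>2)"
      using ultra[of "\<lambda>i. (\<Sum>t<D i. g i t * (cmod (hm i t))\<^sup>2) \<le> Inf V - \<eta>"] by (simp add: not_le)
    then have "\<forall>\<^sub>F i in U. norm (z - z') \<le> \<delta>"
      using ev norm_le_sum_coord[of "z - z'"] coord_diff[of z z']
    proof eventually_elim
      case (elim i)
      have par: "(cmod (h i t - h' i t))\<^sup>2 = 2 * (cmod (h i t))\<^sup>2 + 2 * (cmod (h' i t))\<^sup>2 - 4 * (cmod (hm i t))\<^sup>2" for t
      proof -
        have "(cmod (h i t - h' i t))\<^sup>2 + (cmod (h i t + h' i t))\<^sup>2 = 2 * (cmod (h i t))\<^sup>2 + 2 * (cmod (h' i t))\<^sup>2"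
          unfolding cmod_power2 by (simp add: power2_eq_square algebra_simps)
        then show ?thesis by (simp add: hm_def norm_divide power_divide)
      qed
      have "(\<Sum>t<D i. g i t * (cmod (h i t - h' i t))\<^sup>2) = 2 * (\<Sum>t<D i. g i t * (cmod (h i t))\<^sup>2)
        + 2 * (\<Sum>t<D i. g i t * (cmod (h' i t))\<^sup>2) - 4 * (\<Sum>t<D i. g i t * (cmod (hm i t))\<^sup>2)"
        unfolding par by (simp add: algebra_simps sum.distrib sum_subtractf sum_distrib_left)
      also have "\<dots> \<le> 8 * \<eta>" using elim(1,4,5) v(2) by simp
      finally have energy: "(\<Sum>t<D i. g i t * (cmod (h i t - h' i t))\<^sup>2) \<le> 8 * \<eta>" .
      have young: "a \<le> s + a\<^sup>2 / s" if "0 \<le> a" for a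
      proof -
        have "a * s \<le> s\<^sup>2 + a\<^sup>2"
          using sum_squares_bound[of a s] mult_nonneg_nonneg[of a s] that \<open>0 < s\<close> by linarith
        then show ?thesis using \<open>0 < s\<close> by (simp add: field_simps power2_eq_square)
      qed
      have "(\<Sum>t<D i. g i t * cmod (h i t - h' i t)) \<le> (\<Sum>t<D i. g i t * (s + (cmod (h i t - h' i t))\<^sup>2 / s))"
        by (intro sum_mono mult_left_mono young g_nonneg norm_ge_zero)
      also have "\<dots> = s * (\<Sum>t<D i. g i t) + (\<Sum>t<D i. g i t * (cmod (h i t - h' i t))\<^sup>2) / s"
        by (simp add: algebra_simps sum.distrib sum_distrib_left sum_divide_distrib)
      also have "\<dots> \<le> s * \<Gamma> + 8 * \<eta> / s"
        using sum_g[of i] energy \<open>0 < s\<close> by (intro add_mono mult_left_mono divide_right_mono) auto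
      also have "\<dots> \<le> d + d"
      proof (rule add_mono)
        show "s * \<Gamma> \<le> d" using \<Gamma>_nonneg \<open>0 < d\<close> by (simp add: s_def field_simps)
      qed (use \<open>0 < s\<close> in \<open>simp add: \<eta>_def\<close>)
      finally have gh: "(\<Sum>t<D i. g i t * cmod (h i t - h' i t)) \<le> 2 * d" by simp
      have "cmod (X i (z - z') t) \<le> cmod (X i z t - complex_of_real (g i t) * h i t)
        + cmod (X i z' t - complex_of_real (g i t) * h' i t) + g i t * cmod (h i t - h' i t)" for t
      proof -
        have "X i (z - z') t = (X i z t - complex_of_real (g i t) * h i t)
          - (X i z' t - complex_of_real (g i t) * h' i t) + complex_of_real (g i t) * (h i t - h' i t)"
          using elim(7) by (simp add: algebra_simps)
        then have "cmod (X i (z - z') t) \<le> cmod ((X i z t - complex_of_real (g i t) * h i t)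
          - (X i z' t - complex_of_real (g i t) * h' i t)) + cmod (complex_of_real (g i t) * (h i t - h' i t))"
          by (metis norm_triangle_ineq)
        also have "cmod (complex_of_real (g i t) * (h i t - h' i t)) = g i t * cmod (h i t - h' i t)"
          using g_nonneg[of i t] by (simp add: norm_mult)
        finally show ?thesis
          using norm_triangle_ineq4[of "X i z t - complex_of_real (g i t) * h i t"
            "X i z' t - complex_of_real (g i t) * h' i t"] by linarith
      qed
      then have "(\<Sum>t<D i. cmod (X i (z - z') t)) \<le> (\<Sum>t<D i. cmod (X i z t - complex_of_real (g i t) * h i t)
        + cmod (X i z' t - complex_of_real (g i t) * h' i t) + g i t * cmod (h i t - h' i t))"
        by (rule sum_mono)
      also have "\<dots> \<le> 4 * d" using elim(2,3) gh by (simp add: sum.distrib)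
      finally have "C * (\<Sum>t<D i. cmod (X i (z - z') t)) \<le> C * (4 * d)"
        using C_ge_1 by (intro mult_left_mono) auto
      then show ?case using elim(6) C_ge_1 by (simp add: d_def)
    qed
    then have "norm (z - z') \<le> \<delta>" using nontrivial by simp
    have "F f - cdual_apply f z = (F f - cdual_apply f z') + cdual_apply f (z' - z)"
      by (simp add: cdual_apply_diff)
    then have "cmod (F f - cdual_apply f z) \<le> cmod (F f - cdual_apply f z') + cmod (cdual_apply f (z' - z))"
      by (simp only: norm_triangle_ineq)
    also have "\<dots> \<le> \<epsilon> + norm f * \<delta>"
    proof (rule add_mono)
      have "cmod (cdual_apply f z' - F f) < \<epsilon>" using z' by (simp add: P_def)
      then show "cmod (F f - cdual_apply f z') \<le> \<epsilon>" by (simp add: norm_minus_commute)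
      have "norm f * norm (z' - z) \<le> norm f * \<delta>"
        using \<open>norm (z - z') \<le> \<delta>\<close> by (intro mult_left_mono) (simp_all add: norm_minus_commute)
      then show "cmod (cdual_apply f (z' - z)) \<le> norm f * \<delta>"
        using norm_cdual_apply[of f "z' - z"] by simp
    qed
    finally show "cmod (F f - cdual_apply f z) \<le> \<delta> * norm f + \<epsilon>" by (simp add: mult.commute)
  qed
  then show ?thesis by blast
qed

text \<open>The approximants for errors 1/(n+1) form a Cauchy sequence, since norming functionals
  see their differences, and the limit represents \<open>F\<close> exactly.\<close>

lemma rwc_of_almost_order_bounded:
  assumes aob: "almost_order_bounded B"
  shows "relatively_weakly_compact B"
proof -
  obtain K where K: "\<And>y. y \<in> B \<Longrightarrow> norm y \<le> K" using almost_order_boundedD[OF aob] by blast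
  show ?thesis
  proof (rule relatively_weakly_compactI[OF K])
    fix F :: "'a cdual \<Rightarrow> complex"
    assume F: "\<And>A \<epsilon>. finite A \<Longrightarrow> 0 < \<epsilon> \<Longrightarrow> \<exists>y\<in>B. \<forall>f\<in>A. cmod (cdual_apply f y - F f) < \<epsilon>"
    have "\<exists>z. \<forall>f. cmod (F f - cdual_apply f z) \<le> inverse (real (Suc n)) * norm f" for n
      by (rule weak_star_limit_approx[OF aob _ F]) auto
    then obtain z where z: "\<And>n f. cmod (F f - cdual_apply f (z n)) \<le> inverse (real (Suc n)) * norm f"
      by metis
    have diff: "norm (z n - z m) \<le> C * (inverse (real (Suc n)) + inverse (real (Suc m)))" for n m
    proof -
      obtain f where f: "norm f \<le> 1" "norm (z n - z m) \<le> C * cmod (cdual_apply f (z n - z m))"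
        by (rule norming_functional)
      have "cmod (F f - cdual_apply f (z n)) \<le> inverse (real (Suc n))" for n
        by (rule order_trans[OF z]) (use f(1) in \<open>simp add: mult_left_le\<close>)
      from this[of n] this[of m]
      have "cmod (cdual_apply f (z n - z m)) \<le> inverse (real (Suc n)) + inverse (real (Suc m))"
        using norm_triangle_ineq4[of "F f - cdual_apply f (z m)" "F f - cdual_apply f (z n)"]
        by (simp add: cdual_apply_diff)
      then have "C * cmod (cdual_apply f (z n - z m)) \<le> C * (inverse (real (Suc n)) + inverse (real (Suc m)))"
        using C_ge_1 by (intro mult_left_mono) auto
      with f(2) show ?thesis by simp
    qed
    have "Cauchy z"
    proof (rule metric_CauchyI)
      fix \<epsilon> :: real assume "0 < \<epsilon>"
      obtain N where N: "inverse (real (Suc N)) < \<epsilon> / (2 * C)"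
        using reals_Archimedean[of "\<epsilon> / (2 * C)"] \<open>0 < \<epsilon>\<close> C_ge_1 by auto
      have "dist (z m) (z n) < \<epsilon>" if "N \<le> m" "N \<le> n" for m n
      proof -
        have "inverse (real (Suc m)) \<le> inverse (real (Suc N))" "inverse (real (Suc n)) \<le> inverse (real (Suc N))"
          using that by (auto intro!: le_imp_inverse_le)
        moreover have "\<epsilon> / (2 * C) + \<epsilon> / (2 * C) = \<epsilon> / C" by simp
        ultimately have "inverse (real (Suc m)) + inverse (real (Suc n)) < \<epsilon> / C"
          using N by linarith
        then have "C * (inverse (real (Suc m)) + inverse (real (Suc n))) < \<epsilon>"
          using C_ge_1 by (simp add: field_simps)
        then show ?thesis using diff[of m n] by (simp add: dist_norm)
      qed
      then show "\<exists>M. \<forall>m\<ge>M. \<forall>n\<ge>M. dist (z m) (z n) < \<epsilon>" by blast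
    qed
    then obtain z0 where z0: "z \<longlonglongrightarrow> z0" using Cauchy_convergent convergent_def by blast
    have "F f = cdual_apply f z0" for f
    proof (rule LIMSEQ_unique)
      show "(\<lambda>n. cdual_apply f (z n)) \<longlonglongrightarrow> cdual_apply f z0"
        using continuous_cdual_apply[of f] z0 by (rule continuous_on_tendsto_compose) auto
      have "(\<lambda>n. inverse (real (Suc n)) * norm f) \<longlonglongrightarrow> 0"
        using tendsto_mult_left_zero[OF LIMSEQ_inverse_real_of_nat] .
      then have "(\<lambda>n. F f - cdual_apply f (z n)) \<longlonglongrightarrow> 0"
        by (rule Lim_null_comparison[rotated]) (use z in auto)
      then show "(\<lambda>n. cdual_apply f (z n)) \<longlonglongrightarrow> F f"
        using tendsto_diff[OF tendsto_const[of "F f"]] by force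
    qed
    then show "\<exists>z. \<forall>f. F f = cdual_apply f z" by blast
  qed
qed

section \<open>The remaining implications\<close>

lemma almost_order_bounded_of_rwc:
  assumes rwc: "relatively_weakly_compact B"
  shows "almost_order_bounded B"
proof (rule ccontr)
  assume neg: "\<not> almost_order_bounded B"
  \<comment> \<open>The disjoint-set construction needs a norm bound on \<open>B\<close>. Uniform
    boundedness is applied to evaluations on the dual, which is complete; norming functionals bring
    the bound back to \<open>B\<close>.\<close>
  have "bounded (eval_cdual ` B)"
  proof (rule uniform_boundedness)
    show "bounded ((\<lambda>\<phi>. cdual_apply \<phi> f) ` eval_cdual ` B)" for f
      using rwc_weakly_bounded[OF rwc, of f] by (simp add: image_image)
  qed
  then obtain b where b: "0 < b" "\<And>y. y \<in> B \<Longrightarrow> norm (eval_cdual y) \<le> b"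
    unfolding bounded_pos by blast
  have "norm y \<le> C * b" if "y \<in> B" for y
  proof -
    obtain f where f: "norm f \<le> 1" "norm y \<le> C * cmod (cdual_apply f y)"
      by (rule norming_functional)
    have "cmod (cdual_apply f y) \<le> norm (eval_cdual y) * norm f"
      using norm_cdual_apply[of "eval_cdual y" f] by simp
    also have "\<dots> \<le> b * 1" using b that f by (intro mult_mono) auto
    finally have "C * cmod (cdual_apply f y) \<le> C * b" using C_ge_1 by (intro mult_left_mono) auto
    with f(2) show ?thesis by simp
  qed
  moreover have "0 < C * b" using b(1) C_ge_1 by simp
  ultimately obtain c and y :: "nat \<Rightarrow> 'a" and \<phi> :: "nat \<Rightarrow> 'a cdual" where *: "0 < c" "\<And>j. y j \<in> B"
    "\<And>n x. (\<Sum>j<n. cmod (cdual_apply (\<phi> j) x)) \<le> norm x" "\<And>j. c \<le> cmod (cdual_apply (\<phi> j) (y j))"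
    using wuC_of_not_almost_order_bounded[OF neg] by metis
  show False by (rule rwc_no_wuC_lower_bound[OF rwc *(2,3,1,4)])
qed

text \<open>Functionals on disjoint sets are admissible for every length \<open>n\<close> and give
  q-th power sums of at least \<open>c powr q * n\<close>, so the averages cannot fall to
  \<open>c / 2\<close>.\<close>

lemma almost_order_bounded_of_multi_sup:
  assumes p: "1 \<le> p" and q: "1 \<le> q" and lim: "multi_sup p q B \<longlonglongrightarrow> 0"
  shows "almost_order_bounded B"
proof (rule ccontr)
  assume neg: "\<not> almost_order_bounded B"
  have small: "\<exists>n>0. multi_sup p q B n \<le> ennreal c" if "0 < c" for c
  proof -
    have "eventually (\<lambda>n. multi_sup p q B n < ennreal c) sequentially"
      using lim that by (intro order_tendstoD(2)[OF lim]) simp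
    then have "eventually (\<lambda>n. multi_sup p q B n < ennreal c \<and> 0 < n) sequentially"
      using eventually_gt_at_top[of 0] by (rule eventually_conj)
    then show ?thesis using eventually_happens less_imp_le sequentially_bot by blast
  qed
  obtain m where m: "0 < m" "multi_sup p q B m \<le> ennreal 1" using small[of 1] by auto
  have "norm y \<le> C * m" if "y \<in> B" for y
  proof -
    obtain f where f: "norm f \<le> 1" "norm y \<le> C * cmod (cdual_apply f y)"
      by (rule norming_functional)
    \<comment> \<open>For the norm bound a single functional, completed by zeros, is tested on a
      constant tuple.\<close>
    define f' where "f' i = (if i = (0::nat) then f else 0)" for i
    have single: "(\<Sum>i<m. if i = 0 then a else 0) = (a::real)" for a
      using m(1) by (simp add: sum.delta)
    have "weak_summing_norm p m f' \<le> 1"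
    proof (rule weak_summing_norm_wuC[OF p])
      fix x
      have "(\<Sum>j<m. cmod (cdual_apply (f' j) x)) = (\<Sum>j<m. if j = 0 then cmod (cdual_apply f x) else 0)"
        by (intro sum.cong) (auto simp: f'_def)
      also have "\<dots> = cmod (cdual_apply f x)" by (rule single)
      also have "\<dots> \<le> norm x"
        using norm_cdual_apply[of f x] mult_right_mono[OF f(1), of "norm x"] by simp
      finally show "(\<Sum>j<m. cmod (cdual_apply (f' j) x)) \<le> norm x" .
    qed
    then have "(\<Sum>i<m. cmod (cdual_apply (f' i) y) powr q) \<le> 1 powr q * m"
      using m that multi_sup_le_iff[OF q m(1), of 1 p B] by auto
    moreover have "(\<Sum>i<m. cmod (cdual_apply (f' i) y) powr q)
        = (\<Sum>i<m. if i = 0 then cmod (cdual_apply f y) powr q else 0)"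
      by (intro sum.cong) (auto simp: f'_def)
    ultimately have le: "cmod (cdual_apply f y) powr q \<le> m" by (simp add: single)
    have "cmod (cdual_apply f y) \<le> m"
    proof (cases "cmod (cdual_apply f y) \<le> 1")
      case False
      then have "cmod (cdual_apply f y) powr 1 \<le> cmod (cdual_apply f y) powr q"
        using q by (intro powr_mono) auto
      then show ?thesis using le False by simp
    qed (use m(1) in simp)
    then have "C * cmod (cdual_apply f y) \<le> C * m" using C_ge_1 by (intro mult_left_mono) auto
    with f(2) show ?thesis by simp
  qed
  moreover have "0 < C * m" using m(1) C_ge_1 by simp
  ultimately obtain c and y :: "nat \<Rightarrow> 'a" and \<phi> :: "nat \<Rightarrow> 'a cdual" where *: "0 < c" "\<And>j. y j \<in> B"
    "\<And>n x. (\<Sum>j<n. cmod (cdual_apply (\<phi> j) x)) \<le> norm x" "\<And>j. c \<le> cmod (cdual_apply (\<phi> j) (y j))"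
    using wuC_of_not_almost_order_bounded[OF neg] by metis
  obtain n where n: "0 < n" "multi_sup p q B n \<le> ennreal (c / 2)" using small[of "c / 2"] \<open>0 < c\<close> by auto
  have "weak_summing_norm p n \<phi> \<le> 1" by (rule weak_summing_norm_wuC[OF p *(3)])
  then have "(\<Sum>i<n. cmod (cdual_apply (\<phi> i) (y i)) powr q) \<le> (c / 2) powr q * n"
    using n *(1,2) multi_sup_le_iff[OF q n(1), of "c / 2" p B] by auto
  moreover have "c powr q * n \<le> (\<Sum>i<n. cmod (cdual_apply (\<phi> i) (y i)) powr q)"
    using sum_bounded_below[of "{..<n}" "c powr q" "\<lambda>i. cmod (cdual_apply (\<phi> i) (y i)) powr q"]
      *(1,4) q by (simp add: powr_mono2 mult.commute)
  moreover have "(c / 2) powr q * n < c powr q * n"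
    using *(1) n(1) q by (intro mult_strict_right_mono powr_less_mono2) auto
  ultimately show False by simp
qed

text \<open>Split the coordinates of each point into a part below the common majorant
  \<open>g\<close> and its excess. The first part leads to sums over \<open>j\<close> of the moduli
  of f_j(e_t), which are o(n) uniformly in \<open>t\<close>; the second costs
  \<open>C * \<delta>\<close> per entry.\<close>

lemma multi_sup_of_almost_order_bounded:
  assumes p: "1 \<le> p" and q: "1 \<le> q" and aob: "almost_order_bounded B"
  shows "multi_sup p q B \<longlonglongrightarrow> 0"
proof -
  obtain K where "0 < K" and K: "\<And>y. y \<in> B \<Longrightarrow> norm y \<le> K" using almost_order_boundedD[OF aob] by blast
  have ev: "eventually (\<lambda>n. multi_sup p q B n \<le> ennreal \<epsilon>) sequentially" if "0 < \<epsilon>" for \<epsilon>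
  proof -
    \<comment> \<open>A bound \<open>\<beta> * n\<close> for first powers suffices: all values are
      at most \<open>K\<close>, so q-th powers cost a factor \<open>K powr (q - 1)\<close>.\<close>
    define \<beta> where "\<beta> = \<epsilon> powr q / K powr (q - 1)"
    have "0 < \<beta>" using \<open>0 < \<epsilon>\<close> \<open>0 < K\<close> by (simp add: \<beta>_def)
    define \<delta> where "\<delta> = \<beta> / (3 * C)"
    have "0 < \<delta>" using \<open>0 < \<beta>\<close> C_ge_1 by (simp add: \<delta>_def)
    then obtain k x where kx: "\<And>y. y \<in> B \<Longrightarrow> \<forall>\<^sub>F i in U. excess i y k x \<le> \<delta>"
      using aob unfolding almost_order_bounded_def by meson
    define g where "g i t = (\<Sum>m<k. cmod (X i (x m) t))" for i t
    have g_nonneg: "0 \<le> g i t" for i t by (simp add: g_def sum_nonneg)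
    define \<Gamma> where "\<Gamma> = (\<Sum>m<k. norm (x m))"
    have \<Gamma>_nonneg: "0 \<le> \<Gamma>" by (simp add: \<Gamma>_def sum_nonneg)
    have sum_g: "(\<Sum>t<D i. g i t) \<le> \<Gamma>" for i
      unfolding g_def \<Gamma>_def by (rule sum_majorant_le)
    \<comment> \<open>One third of \<beta> each goes to the excess through \<delta>, to the
      threshold \<open>s\<close>, and to the constant term, which needs \<open>n\<close> large. All
      three are fixed before the tuples of points and functionals.\<close>
    define s where "s = \<beta> / (3 * (\<Gamma> + 1))"
    have "0 < s" using \<open>0 < \<beta>\<close> \<Gamma>_nonneg by (simp add: s_def)
    have "eventually (\<lambda>n. \<Gamma> * (s powr (1 - p) * C powr p) * 3 / \<beta> \<le> real n) sequentially"
      using filterlim_real_sequentially filterlim_at_top by blast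
    then show ?thesis using eventually_gt_at_top[of 0]
    proof eventually_elim
      case (elim n)
      show ?case
        unfolding multi_sup_le_iff[OF q elim(2) less_imp_le[OF \<open>0 < \<epsilon>\<close>]]
      proof (intro allI impI)
        fix y :: "nat \<Rightarrow> 'a" and f :: "nat \<Rightarrow> 'a cdual"
        assume y: "\<forall>i<n. y i \<in> B" and f: "weak_summing_norm p n f \<le> 1"
        \<comment> \<open>The tuple is finite, so a single index \<open>i\<close> serves all its
          entries. It may depend on the tuple because it does not enter the final bound.\<close>
        have "\<forall>\<^sub>F i in U. \<forall>j\<in>{..<n}. excess i (y j) k x \<le> \<delta> \<and>
          (\<forall>f. cdual_apply f (y j) = (\<Sum>t<D i. X i (y j) t * cdual_apply f (e i t)))"
          using y by (intro eventually_ball_finite ballI eventually_conj kx apply_expansion) auto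
        then obtain i where i: "\<And>j. j < n \<Longrightarrow> excess i (y j) k x \<le> \<delta>"
          "\<And>j f. j < n \<Longrightarrow> cdual_apply f (y j) = (\<Sum>t<D i. X i (y j) t * cdual_apply f (e i t))"
          using eventually_happens'[OF nontrivial] by fastforce
        have C_pos: "0 < C" using C_ge_1 by simp
        have single: "cmod (cdual_apply (f j) (y j)) \<le>
          (\<Sum>t<D i. cmod (cdual_apply (f j) (e i t)) * g i t) + C * \<delta>" if "j < n" for j
        proof -
          have "cmod (cdual_apply (f j) (y j)) \<le> (\<Sum>t<D i. cmod (X i (y j) t) * cmod (cdual_apply (f j) (e i t)))"
            unfolding i(2)[OF that] by (rule order_trans[OF norm_sum]) (simp add: norm_mult)
          also have "\<dots> \<le> (\<Sum>t<D i. cmod (cdual_apply (f j) (e i t)) * g i t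
              + C * max 0 (cmod (X i (y j) t) - g i t))"
          proof (rule sum_mono)
            fix t assume "t \<in> {..<D i}"
            then have "cmod (cdual_apply (f j) (e i t)) \<le> C"
              by (intro weak_summing_norm_apply_le[OF p f _ C_pos that] norm_basis) simp
            then have "cmod (cdual_apply (f j) (e i t)) * max 0 (cmod (X i (y j) t) - g i t)
              \<le> C * max 0 (cmod (X i (y j) t) - g i t)"
              by (intro mult_right_mono) auto
            moreover have "cmod (X i (y j) t) * cmod (cdual_apply (f j) (e i t)) \<le>
              (g i t + max 0 (cmod (X i (y j) t) - g i t)) * cmod (cdual_apply (f j) (e i t))"
              by (intro mult_right_mono) auto
            ultimately show "cmod (X i (y j) t) * cmod (cdual_apply (f j) (e i t)) \<le>
              cmod (cdual_apply (f j) (e i t)) * g i t + C * max 0 (cmod (X i (y j) t) - g i t)"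
              by (simp add: algebra_simps)
          qed
          also have "\<dots> = (\<Sum>t<D i. cmod (cdual_apply (f j) (e i t)) * g i t) + C * excess i (y j) k x"
            by (simp add: sum.distrib sum_distrib_left excess_def g_def)
          also have "\<dots> \<le> (\<Sum>t<D i. cmod (cdual_apply (f j) (e i t)) * g i t) + C * \<delta>"
            using i(1)[OF that] C_pos by simp
          finally show ?thesis .
        qed
        have basis: "(\<Sum>j<n. cmod (cdual_apply (f j) (e i t))) \<le> n * s + s powr (1 - p) * C powr p"
          if "t < D i" for t
        proof -
          have "(\<Sum>j<n. cmod (cdual_apply (f j) (e i t))) \<le>
            (\<Sum>j<n. s + s powr (1 - p) * cmod (cdual_apply (f j) (e i t)) powr p)"
            by (intro sum_mono le_add_powr \<open>0 < s\<close> p norm_ge_zero)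
          also have "\<dots> = n * s + s powr (1 - p) * (\<Sum>j<n. cmod (cdual_apply (f j) (e i t)) powr p)"
            by (simp add: sum.distrib sum_distrib_left)
          also have "\<dots> \<le> n * s + s powr (1 - p) * C powr p"
            using weak_summing_norm_apply[OF p f norm_basis[OF that] C_pos]
            by (intro add_left_mono mult_left_mono) auto
          finally show ?thesis .
        qed
        have "(\<Sum>j<n. cmod (cdual_apply (f j) (y j))) \<le>
          (\<Sum>j<n. (\<Sum>t<D i. cmod (cdual_apply (f j) (e i t)) * g i t) + C * \<delta>)"
          by (intro sum_mono single) simp
        also have "\<dots> = (\<Sum>t<D i. (\<Sum>j<n. cmod (cdual_apply (f j) (e i t))) * g i t) + n * (C * \<delta>)"
          by (simp add: sum.distrib sum_distrib_right) (rule sum.swap)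
        also have "\<dots> \<le> (\<Sum>t<D i. (n * s + s powr (1 - p) * C powr p) * g i t) + n * (C * \<delta>)"
          by (intro add_right_mono sum_mono mult_right_mono basis g_nonneg) simp
        also have "\<dots> = (n * s + s powr (1 - p) * C powr p) * (\<Sum>t<D i. g i t) + n * (C * \<delta>)"
          by (simp add: sum_distrib_left)
        also have "\<dots> \<le> (n * s + s powr (1 - p) * C powr p) * \<Gamma> + n * (C * \<delta>)"
          using \<open>0 < s\<close> sum_g[of i] by (intro add_right_mono mult_left_mono) auto
        also have "\<dots> = n * (s * \<Gamma>) + \<Gamma> * (s powr (1 - p) * C powr p) + n * (C * \<delta>)"
          by (simp add: algebra_simps)
        also have "\<dots> \<le> n * (\<beta> / 3) + n * (\<beta> / 3) + n * (\<beta> / 3)"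
        proof (intro add_mono mult_left_mono)
          show "s * \<Gamma> \<le> \<beta> / 3" using \<Gamma>_nonneg \<open>0 < \<beta>\<close> by (simp add: s_def field_simps)
          show "\<Gamma> * (s powr (1 - p) * C powr p) \<le> n * (\<beta> / 3)"
            using elim(1) \<open>0 < \<beta>\<close> by (simp add: field_simps)
          show "C * \<delta> \<le> \<beta> / 3" using C_pos by (simp add: \<delta>_def)
        qed auto
        finally have total: "(\<Sum>j<n. cmod (cdual_apply (f j) (y j))) \<le> \<beta> * n" by simp
        have "(\<Sum>j<n. cmod (cdual_apply (f j) (y j)) powr q) \<le> (\<Sum>j<n. K powr (q - 1) * cmod (cdual_apply (f j) (y j)))"
        proof (rule sum_mono)
          fix j assume "j \<in> {..<n}"
          then have "cmod (cdual_apply (f j) (y j)) \<le> K"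
            using y K by (intro weak_summing_norm_apply_le[OF p f _ \<open>0 < K\<close>]) auto
          then have "cmod (cdual_apply (f j) (y j)) powr (q - 1) \<le> K powr (q - 1)"
            using q by (intro powr_mono2) auto
          then have "cmod (cdual_apply (f j) (y j)) powr (q - 1) * cmod (cdual_apply (f j) (y j))
            \<le> K powr (q - 1) * cmod (cdual_apply (f j) (y j))"
            by (intro mult_right_mono) auto
          moreover have "cmod (cdual_apply (f j) (y j)) powr (q - 1) * cmod (cdual_apply (f j) (y j))
            = cmod (cdual_apply (f j) (y j)) powr q"
            by (cases "cdual_apply (f j) (y j) = 0") (simp_all add: powr_diff)
          ultimately show "cmod (cdual_apply (f j) (y j)) powr q \<le> K powr (q - 1) * cmod (cdual_apply (f j) (y j))"
            by simp
        qed
        also have "\<dots> \<le> K powr (q - 1) * (\<beta> * n)"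
          unfolding sum_distrib_left[symmetric] by (intro mult_left_mono total) simp
        also have "\<dots> = \<epsilon> powr q * n" using \<open>0 < K\<close> by (simp add: \<beta>_def)
        finally show "(\<Sum>j<n. cmod (cdual_apply (f j) (y j)) powr q) \<le> \<epsilon> powr q * n" .
      qed
    qed
  qed
  show ?thesis
  proof (rule order_tendstoI)
    fix a :: ennreal assume "0 < a"
    then obtain b where b: "0 < b" "b < a" using dense by blast
    then have "0 < enn2real b" "ennreal (enn2real b) = b"
      by (auto simp: enn2real_positive_iff less_top[symmetric] intro!: ennreal_enn2real elim: order_less_le_trans)
    with ev[of "enn2real b"] b(2) show "eventually (\<lambda>n. multi_sup p q B n < a) sequentially"
      by (auto elim!: eventually_mono)
  qed simp
qed

lemma rwc_iff_almost_multi_bounded: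
  fixes B :: "'a set"
  assumes p: "1 \<le> p" and q: "1 \<le> q"
  shows "relatively_weakly_compact B \<longleftrightarrow> almost_multi_bounded p q B"
  unfolding almost_multi_bounded_iff_tendsto[OF p q]
  using rwc_of_almost_order_bounded almost_order_bounded_of_rwc
    almost_order_bounded_of_multi_sup[OF p q] multi_sup_of_almost_order_bounded[OF p q] by blast

end

section \<open>Coordinates on Lindenstrauss--Pelczynski spaces\<close>

lemma ell_norm_1: "ell_norm 1 n v = (\<Sum>i<n. cmod (v i))"
  by (simp add: ell_norm_def p_sum_def sum_nonneg)

text \<open>Dividing the isomorphism by its norm and multiplying the basis vectors by the same
  number makes the coordinates contractive and leaves the whole distortion \<open>C\<close> on the
  basis.\<close>

lemma ell1_iso_coordinates:
  fixes N :: "'a::complex_normed_vector set"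
  assumes N: "complex_vector.subspace N" and T: "linear_iso_ell N n T"
    and le: "norm_to_ell 1 N n T * norm_from_ell 1 n (inv_into N T) \<le> ennreal C" and "0 \<le> C"
  obtains Y b where "\<And>x. x \<in> N \<Longrightarrow> (\<Sum>t<n. cmod (Y x t)) \<le> norm x"
    "\<And>x. x \<in> N \<Longrightarrow> x = (\<Sum>t<n. Y x t *\<^sub>C b t)" "\<And>t. t < n \<Longrightarrow> norm (b t) \<le> C"
    "\<And>x y t. x \<in> N \<Longrightarrow> y \<in> N \<Longrightarrow> Y (x + y) t = Y x t + Y y t"
    "\<And>c x t. x \<in> N \<Longrightarrow> Y (c *\<^sub>C x) t = c * Y x t"
proof -
  define S where "S = inv_into N T"
  have inj: "inj_on T N" and img: "T ` N = ell_space n"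
    using T by (auto simp: linear_iso_ell_def bij_betw_def)
  have lin: "T (a *\<^sub>C x + b *\<^sub>C y) = (\<lambda>i. a * T x i + b * T y i)" if "x \<in> N" "y \<in> N" for a b x y
    using T that by (simp add: linear_iso_ell_def)
  have TS: "T (S v) = v" and SN: "S v \<in> N" if "v \<in> ell_space n" for v
    using that by (simp_all add: S_def f_inv_into_f inv_into_into flip: img)
  have T_add: "T (x + y) t = T x t + T y t" if "x \<in> N" "y \<in> N" for x y t
    using lin[OF that, of 1 1] by simp
  have T_scale: "T (c *\<^sub>C x) t = c * T x t" if "x \<in> N" for c x t
    using lin[OF that that, of c 0] by simp
  have zero: "0 \<in> N" using N by (rule complex_vector.subspace_0)
  have T_zero: "T 0 t = 0" for t using T_scale[OF zero, of 0] by simp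
  have T_sum: "T (\<Sum>t\<in>I. c t *\<^sub>C s t) i = (\<Sum>t\<in>I. c t * T (s t) i)"
    if "finite I" "\<And>t. t \<in> I \<Longrightarrow> s t \<in> N" for I :: "nat set" and c s i
    using that
  proof (induction I)
    case (insert j I)
    have "(\<Sum>t\<in>I. c t *\<^sub>C s t) \<in> N"
      using insert.prems N by (intro complex_vector.subspace_sum complex_vector.subspace_scale) auto
    then show ?case
      using insert N by (simp add: T_add T_scale complex_vector.subspace_scale)
  qed (simp add: T_zero)
  define u where "u t = (\<lambda>i::nat. if i = t then 1 else 0 :: complex)" for t
  have u: "u t \<in> ell_space n" "ell_norm 1 n (u t) = 1" if "t < n" for t
    using that by (auto simp: ell_space_def u_def ell_norm_1 if_distrib[of cmod] cong: if_cong)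
  have expand: "x = (\<Sum>t<n. T x t *\<^sub>C S (u t))" if x: "x \<in> N" for x
  proof (rule inj_onD[OF inj _ x])
    show "(\<Sum>t<n. T x t *\<^sub>C S (u t)) \<in> N"
      using N u SN by (intro complex_vector.subspace_sum complex_vector.subspace_scale) auto
    show "T x = T (\<Sum>t<n. T x t *\<^sub>C S (u t))"
    proof
      fix i
      have "T (\<Sum>t<n. T x t *\<^sub>C S (u t)) i = (\<Sum>t<n. T x t * T (S (u t)) i)"
        by (intro T_sum SN u) simp_all
      also have "\<dots> = (\<Sum>t<n. T x t * u t i)"
        by (intro sum.cong) (simp_all add: TS[OF u(1)])
      also have "\<dots> = (\<Sum>t<n. if t = i then T x t else 0)"
        by (intro sum.cong) (auto simp: u_def)
      also have "\<dots> = T x i"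
      proof -
        have "T x \<in> ell_space n" using img x by blast
        then show ?thesis by (simp add: ell_space_def)
      qed
      finally show "T x i = T (\<Sum>t<n. T x t *\<^sub>C S (u t)) i" by simp
    qed
  qed
  have to: "ennreal (\<Sum>t<n. cmod (T x t)) \<le> norm_to_ell 1 N n T" if "x \<in> N" "norm x \<le> 1" for x
    using that unfolding norm_to_ell_def ell_norm_1 by (intro SUP_upper) auto
  have from': "ennreal (norm (S (u t))) \<le> norm_from_ell 1 n (inv_into N T)" if "t < n" for t
    using u[OF that] unfolding norm_from_ell_def S_def by (intro SUP_upper) auto
  show thesis
  \<comment> \<open>In dimension 0 the norm of \<open>T\<close> is 0 and cannot be divided by; there
    are no coordinates to rescale.\<close>
  proof (cases "n = 0")
    case True
    show thesis
      by (rule that[of T "\<lambda>_. 0"]) (use True expand T_add T_scale in auto)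
  next
    case False
    then have "0 < n" by simp
    have S0: "S (u 0) \<in> N" "T (S (u 0)) = u 0" using SN TS u(1)[OF \<open>0 < n\<close>] by auto
    have "S (u 0) \<noteq> 0"
    proof
      assume "S (u 0) = 0"
      then have "u 0 0 = 0" using S0(2) T_zero[of 0] by simp
      then show False by (simp add: u_def)
    qed
    define \<nu> where "\<nu> = norm (S (u 0))"
    have "0 < \<nu>" using \<open>S (u 0) \<noteq> 0\<close> by (simp add: \<nu>_def)
    \<comment> \<open>In \<open>ennreal\<close> the product of 0 and \<open>top\<close> is 0, so a
      finite product makes both norms finite only after both are known to be nonzero.\<close>
    have from_pos: "norm_from_ell 1 n (inv_into N T) \<noteq> 0"
      using from'[OF \<open>0 < n\<close>] \<open>0 < \<nu>\<close> by (auto simp: \<nu>_def[symmetric] ennreal_eq_0_iff)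
    define y where "y = complex_of_real (1 / \<nu>) *\<^sub>C S (u 0)"
    have "y \<in> N" using N S0 by (simp add: y_def complex_vector.subspace_scale)
    moreover have "norm y \<le> 1" using \<open>0 < \<nu>\<close> by (simp add: y_def norm_scaleC norm_divide \<nu>_def)
    moreover have "(\<Sum>t<n. cmod (T y t)) = 1 / \<nu>"
    proof -
      have "(\<Sum>t<n. cmod (T y t)) = (\<Sum>t<n. if t = 0 then 1 / \<nu> else 0)"
        unfolding y_def T_scale[OF S0(1)] S0(2) using \<open>0 < \<nu>\<close>
        by (intro sum.cong) (auto simp: u_def norm_mult norm_divide)
      then show ?thesis using \<open>0 < n\<close> by simp
    qed
    ultimately have to_ge: "ennreal (1 / \<nu>) \<le> norm_to_ell 1 N n T" using to[of y] by simp
    then have to_pos: "norm_to_ell 1 N n T \<noteq> 0"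
      using \<open>0 < \<nu>\<close> by (auto simp: ennreal_eq_0_iff)
    have "norm_to_ell 1 N n T * norm_from_ell 1 n (inv_into N T) \<noteq> top"
      using le by (auto simp: top_unique)
    then have fin: "norm_to_ell 1 N n T \<noteq> top" "norm_from_ell 1 n (inv_into N T) \<noteq> top"
      using to_pos from_pos by (auto simp: ennreal_mult_eq_top_iff)
    define \<alpha> \<beta> where "\<alpha> = enn2real (norm_to_ell 1 N n T)" and "\<beta> = enn2real (norm_from_ell 1 n (inv_into N T))"
    have \<alpha>: "norm_to_ell 1 N n T = ennreal \<alpha>" and \<beta>: "norm_from_ell 1 n (inv_into N T) = ennreal \<beta>"
      using fin by (simp_all add: \<alpha>_def \<beta>_def less_top)
    have "0 \<le> \<beta>" by (simp add: \<beta>_def)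
    have "0 < \<alpha>" using to_pos unfolding \<alpha> by (simp add: ennreal_eq_0_iff not_le)
    have "\<alpha> * \<beta> \<le> C"
      using le \<open>0 \<le> C\<close> \<open>0 < \<alpha>\<close> \<open>0 \<le> \<beta>\<close> by (simp add: \<alpha> \<beta> ennreal_le_iff flip: ennreal_mult)
    have T_bound: "(\<Sum>t<n. cmod (T x t)) \<le> \<alpha> * norm x" if "x \<in> N" for x
    proof (cases "x = 0")
      case False
      define y where "y = complex_of_real (1 / norm x) *\<^sub>C x"
      have "y \<in> N" using N that by (simp add: y_def complex_vector.subspace_scale)
      moreover have "norm y \<le> 1" using False by (simp add: y_def norm_scaleC norm_divide)
      ultimately have "(\<Sum>t<n. cmod (T y t)) \<le> \<alpha>"
        using to[of y] \<open>0 < \<alpha>\<close> by (simp add: \<alpha> ennreal_le_iff)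
      moreover have "(\<Sum>t<n. cmod (T y t)) = (\<Sum>t<n. cmod (T x t)) / norm x"
        unfolding y_def T_scale[OF that] by (simp add: norm_mult norm_divide sum_divide_distrib)
      ultimately show ?thesis using False by (simp add: divide_le_eq)
    qed (simp add: T_zero)
    show thesis
    proof (rule that[of "\<lambda>x t. T x t / complex_of_real \<alpha>" "\<lambda>t. complex_of_real \<alpha> *\<^sub>C S (u t)"])
      fix x assume "x \<in> N"
      show "(\<Sum>t<n. cmod (T x t / complex_of_real \<alpha>)) \<le> norm x"
        using T_bound[OF \<open>x \<in> N\<close>] \<open>0 < \<alpha>\<close>
        by (simp add: norm_divide sum_divide_distrib[symmetric] divide_le_eq mult.commute)
      show "x = (\<Sum>t<n. (T x t / complex_of_real \<alpha>) *\<^sub>C complex_of_real \<alpha> *\<^sub>C S (u t))"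
        using expand[OF \<open>x \<in> N\<close>] \<open>0 < \<alpha>\<close> by (simp add: scaleC_scaleC)
    next
      fix t assume "t < n"
      then have "norm (S (u t)) \<le> \<beta>" using from'[of t] \<open>0 \<le> \<beta>\<close> by (simp add: \<beta> ennreal_le_iff)
      then have "\<alpha> * norm (S (u t)) \<le> \<alpha> * \<beta>" using \<open>0 < \<alpha>\<close> by (intro mult_left_mono) auto
      also note \<open>\<alpha> * \<beta> \<le> C\<close>
      finally show "norm (complex_of_real \<alpha> *\<^sub>C S (u t)) \<le> C"
        using \<open>0 < \<alpha>\<close> by (simp add: norm_scaleC)
    qed (simp_all add: T_add T_scale add_divide_distrib)
  qed
qed

text \<open>The indices are the finite subsets of the space, ordered by inclusion and refined to an
  ultrafilter; each gets the copy of l^1_n around its span.\<close>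

lemma script_L1_coordinates:
  assumes "script_L_space 1 TYPE('a::complex_banach)"
  obtains U D C and X :: "'a::complex_banach set \<Rightarrow> 'a \<Rightarrow> nat \<Rightarrow> complex" and e where "ell1_coordinates U D X e C"
proof -
  obtain C :: real where "1 < C" and C: "\<And>M :: 'a set. fin_dim_subspace M \<Longrightarrow>
      \<exists>N T. fin_dim_subspace N \<and> M \<subseteq> N \<and> linear_iso_ell N (complex_vector.dim N) T \<and>
        norm_to_ell 1 N (complex_vector.dim N) T *
          norm_from_ell 1 (complex_vector.dim N) (inv_into N T) \<le> ennreal C"
    using assms unfolding script_L_space_def by blast
  \<comment> \<open>The index type contains infinite sets as well. They receive dummy data in
    dimension 0 and are ignored by the filter.\<close>
  define good where "good A n X e \<longleftrightarrow> (\<forall>x. (\<Sum>t<n. cmod (X x t)) \<le> norm x) \<and> (\<forall>t<n. norm (e t) \<le> C) \<and>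
    (finite A \<longrightarrow> (\<forall>x\<in>A. x = (\<Sum>t<n. X x t *\<^sub>C e t)) \<and>
      (\<forall>x\<in>A. \<forall>y\<in>A. \<forall>t. X (x + y) t = X x t + X y t) \<and> (\<forall>x\<in>A. \<forall>c t. X (c *\<^sub>C x) t = c * X x t))"
    for A :: "'a set" and n :: nat and X :: "'a \<Rightarrow> nat \<Rightarrow> complex" and e :: "nat \<Rightarrow> 'a"
  have "\<exists>n X e. good A n X e" for A
  proof (cases "finite A")
    case False
    show ?thesis
      by (intro exI[of _ 0] exI[of _ "\<lambda>_ _. 0"] exI[of _ "\<lambda>_. 0"]) (simp add: good_def False)
  next
    case True
    then have "fin_dim_subspace (complex_vector.span A)" by (auto simp: fin_dim_subspace_def)
    then obtain N T where N: "fin_dim_subspace N" "complex_vector.span A \<subseteq> N"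
      and T: "linear_iso_ell N (complex_vector.dim N) T"
        "norm_to_ell 1 N (complex_vector.dim N) T *
          norm_from_ell 1 (complex_vector.dim N) (inv_into N T) \<le> ennreal C"
      using C by blast
    have sub: "complex_vector.subspace N"
      using N(1) by (auto simp: fin_dim_subspace_def complex_vector.subspace_span)
    let ?n = "complex_vector.dim N"
    obtain Y b where Y: "\<And>x. x \<in> N \<Longrightarrow> (\<Sum>t<?n. cmod (Y x t)) \<le> norm x"
      "\<And>x. x \<in> N \<Longrightarrow> x = (\<Sum>t<?n. Y x t *\<^sub>C b t)" "\<And>t. t < ?n \<Longrightarrow> norm (b t) \<le> C"
      "\<And>x y t. x \<in> N \<Longrightarrow> y \<in> N \<Longrightarrow> Y (x + y) t = Y x t + Y y t"
      "\<And>c x t. x \<in> N \<Longrightarrow> Y (c *\<^sub>C x) t = c * Y x t"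
      using ell1_iso_coordinates[OF sub T] \<open>1 < C\<close> by auto
    \<comment> \<open>Extension by 0 keeps the contractive bound valid for every vector at every
      index, while linearity is claimed only on \<open>A\<close>.\<close>
    define X where "X x t = (if x \<in> N then Y x t else 0)" for x t
    have "good A ?n X b"
      unfolding good_def
    proof (intro conjI impI allI ballI)
      have AN: "x \<in> N" if "x \<in> A" for x
        using N(2) complex_vector.span_superset that by (blast intro: complex_vector.span_base)
      show "(\<Sum>t<?n. cmod (X x t)) \<le> norm x" for x
        using Y(1) by (cases "x \<in> N") (simp_all add: X_def)
      show "norm (b t) \<le> C" if "t < ?n" for t using that by (rule Y(3))
      show "x = (\<Sum>t<?n. X x t *\<^sub>C b t)" if "x \<in> A" for x
        unfolding X_def if_P[OF AN[OF that]] by (rule Y(2)[OF AN[OF that]])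
      show "X (x + y) t = X x t + X y t" if "x \<in> A" "y \<in> A" for x y t
        using sub Y(4) AN that by (simp add: X_def complex_vector.subspace_add)
      show "X (c *\<^sub>C x) t = c * X x t" if "x \<in> A" for c x t
        using sub Y(5) AN that by (simp add: X_def complex_vector.subspace_scale)
    qed
    then show ?thesis by blast
  qed
  then obtain D X e where DXe: "\<And>A. good A (D A) (X A) (e A)" by metis
  obtain U where U: "U \<noteq> bot" "U \<le> finite_subsets_at_top (UNIV :: 'a set)"
    "\<And>P. eventually P U \<or> eventually (\<lambda>A. \<not> P A) U"
    using ultrafilter_below[OF finite_subsets_at_top_neq_bot] by blast
  have ev: "eventually (\<lambda>A. finite A \<and> {x, y} \<subseteq> A) U" for x y :: 'a
  proof (rule filter_leD[OF U(2)])
    show "eventually (\<lambda>A. finite A \<and> {x, y} \<subseteq> A) (finite_subsets_at_top UNIV)"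
      unfolding eventually_finite_subsets_at_top
    proof (intro exI[of _ "{x, y}"] conjI allI impI)
      fix Y assume "finite Y \<and> {x, y} \<subseteq> Y \<and> Y \<subseteq> UNIV"
      then show "finite Y" "{x, y} \<subseteq> Y" by blast+
    qed (rule finite.emptyI finite.insertI subset_UNIV)+
  qed
  have "ell1_coordinates U D X e C"
  proof
    show "\<forall>\<^sub>F A in U. x = (\<Sum>t<D A. X A x t *\<^sub>C e A t)" for x
    proof (rule eventually_mono[OF ev[of x x]])
      fix A assume "finite A \<and> {x, x} \<subseteq> A"
      then have "finite A" "x \<in> A" by auto
      from DXe[of A] this(1) have "\<forall>x\<in>A. x = (\<Sum>t<D A. X A x t *\<^sub>C e A t)"
        unfolding good_def by (elim conjE impE)
      then show "x = (\<Sum>t<D A. X A x t *\<^sub>C e A t)" using \<open>x \<in> A\<close> by (rule bspec)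
    qed
    show "\<forall>\<^sub>F A in U. \<forall>t. X A (x + y) t = X A x t + X A y t" for x y
      by (rule eventually_mono[OF ev[of x y]]) (use DXe in \<open>simp add: good_def\<close>)
    show "\<forall>\<^sub>F A in U. \<forall>t. X A (c *\<^sub>C x) t = c * X A x t" for c x
      by (rule eventually_mono[OF ev[of x x]]) (use DXe in \<open>simp add: good_def\<close>)
    show "(\<Sum>t<D A. cmod (X A x t)) \<le> norm x" for A x
      using DXe[of A] by (simp add: good_def)
    show "norm (e A t) \<le> C" if "t < D A" for A t
      using DXe[of A] that by (simp add: good_def)
  qed (use U \<open>1 < C\<close> in auto)
  then show thesis by (rule that)
qed

theorem theorem4p5:
  fixes B :: "'a::complex_banach set" and p q :: real
  assumes "script_L_space 1 TYPE('a)"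
    and "1 \<le> p" and "1 \<le> q"
  shows "relatively_weakly_compact B \<longleftrightarrow> almost_multi_bounded p q B"
proof -
  obtain U D C and X :: "'a set \<Rightarrow> 'a \<Rightarrow> nat \<Rightarrow> complex" and e where "ell1_coordinates U D X e C"
    by (rule script_L1_coordinates[OF assms(1)])
  then show ?thesis
    using assms(2,3) by (rule ell1_coordinates.rwc_iff_almost_multi_bounded)
qed

end
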